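(* Let $f_1(\mathbf{x}_1,\mathbf{x}_2)$ and $f_2(\mathbf{x}_1,\mathbf{x}_2)$ be scalar functions of $\mathbf{x}_1\in\mathbb{R}^{n_1}$, $\mathbf{x}_2\in\mathbb{R}^{n_2}$, let $\mathbf{M}_1(\mathbf{x}_1)$ and $\mathbf{M}_2(\mathbf{x}_2)$ be metrics on $\mathbb{R}^{n_1}$ and $\mathbb{R}^{n_2}$, and consider the two-player natural gradient dynamics $$\dot{\mathbf{x}}_1=-\mathbf{M}_1(\mathbf{x}_1)^{-1}\nabla_{\mathbf{x}_1}f_1(\mathbf{x}_1,\mathbf{x}_2),\qquad \dot{\mathbf{x}}_2=-\mathbf{M}_2(\mathbf{x}_2)^{-1}\nabla_{\mathbf{x}_2}f_2(\mathbf{x}_1,\mathbf{x}_2).$$ Suppose that: (a) $f_1$ is geodesically $\alpha_1$-strongly convex in $\mathbf{x}_1$, with $\alpha_1>0$, in a uniformly positive definite metric $\mathbf{M}_1(\mathbf{x}_1)$ for each $\mathbf{x}_2$; (b) the Riemannian Hessian $\mathbf{H}_2(\mathbf{x}_1,\mathbf{x}_2)$ of $f_2(\mathbf{x}_1,\mathbf{x}_2)$ in $\mathbf{x}_2$ is (only) positive semi-definite for each $\mathbf{x}_1$ in a uniformly positive definite metric $\mathbf{M}_2(\mathbf{x}_2)$; (c) the scaled skew-symmetry property $$\nabla_{\mathbf{x}_1\mathbf{x}_2}f_1=-k\,\nabla_{\mathbf{x}_1\mathbf{x}_2}f_2$$ holds for some strictly positive constant $k$. Assume that one trajectory of the dynamics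 is bounded. Then every trajectory of the dynamics converges to a Nash equilibrium $(\mathbf{x}_1^*,\mathbf{x}_2^* )$. Moreover, $\mathbf{x}_1^*$ does not depend on initial conditions (i.e., every Nash equilibrium has the same strategy for player 1).
   Context: All functions are assumed sufficiently smooth that derivatives of the necessary order exist and are continuous. A metric is a matrix-valued function with symmetric positive definite values; it is uniformly positive definite if $\mathbf{M}(\mathbf{x})\succeq\beta\mathbf{I}$ for all $\mathbf{x}$ for some constant $\beta>0$. $\nabla_{\mathbf{x}_1\mathbf{x}_2}f$ denotes the matrix of mixed second partial derivatives of $f$ with respect to the components of $\mathbf{x}_1$ and $\mathbf{x}_2$. Riemannian Hessian: for a function $f(\mathbf{x})$ and metric $\mathbf{M}(\mathbf{x})$, $H_{ij}=\frac{\partial^2 f}{\partial x_i\partial x_j}-\sum_k\Gamma_{ij}^k\frac{\partial f}{\partial x_k}$ with $\Gamma_{ij}^m=\frac12\sum_k M^{mk}\left(\frac{\partial M_{ik}}{\partial x_j}+\frac{\partial M_{jk}}{\partial x_i}-\frac{\partial M_{ij}}{\partial x_k}\right)$ and $M^{ij}=(\mathbf{M}^{-1})_{ij}$; when $f$ depends on further variables these are held fixed. The function $f$ is geodesically $\alpha$-strongly convex in $\mathbf{M}$ if $\mathbf{H}(\mathbf{x})\succeq\alpha\mathbf{M}(\mathbf{x})$ for all $\mathbf{x}$. A Nash equilibrium is a point $(\mathbf{x}_1^*,\mathbf{x}_2^* )$ such that $\mathbf{x}_1^*$ minimizes $f_1(\cdot,\mathbf{x}_2^* )$ and $\mathbf{x}_2^*$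 minimizes $f_2(\mathbf{x}_1^*,\cdot)$. *)

theory Defs
  imports "HOL-Analysis.Analysis"
begin

text \<open>Functions of class \<open>C\<^sup>k\<close> on the whole space.\<close>

primrec C_class :: "nat \<Rightarrow> ('a::euclidean_space \<Rightarrow> 'b::real_normed_vector) \<Rightarrow> bool" where
  "C_class 0 f \<longleftrightarrow> continuous_on UNIV f"
| "C_class (Suc k) f \<longleftrightarrow> (\<forall>x. f differentiable (at x)) \<and>
     (\<forall>b\<in>Basis. C_class k (\<lambda>x. frechet_derivative f (at x) b))"

definition partial_deriv :: "'n::finite \<Rightarrow> (real^'n \<Rightarrow> real) \<Rightarrow> real^'n \<Rightarrow> real" where
  "partial_deriv i f x = frechet_derivative f (at x) (axis i 1)"

definition gradient :: "(real^'n::finite \<Rightarrow> real) \<Rightarrow> real^'n \<Rightarrow> real^'n" where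
  "gradient f x = (\<chi> i. partial_deriv i f x)"

text \<open>Rows are indexed by the components of the first argument, columns by those of the second.\<close>

definition mixed_hessian ::
  "(real^'m::finite \<Rightarrow> real^'n::finite \<Rightarrow> real) \<Rightarrow> real^'m \<Rightarrow> real^'n \<Rightarrow> real^'n^'m" where
  "mixed_hessian f x1 x2 = (\<chi> i j. partial_deriv i (\<lambda>y1. partial_deriv j (\<lambda>y2. f y1 y2) x2) x1)"

definition positive_definite :: "real^'n^'n::finite \<Rightarrow> bool" where
  "positive_definite A \<longleftrightarrow> transpose A = A \<and> (\<forall>v. v \<noteq> 0 \<longrightarrow> v \<bullet> (A *v v) > 0)"

definition positive_semidefinite :: "real^'n^'n::finite \<Rightarrow> bool" where
  "positive_semidefinite A \<longleftrightarrow> transpose A = A \<and> (\<forall>v. v \<bullet> (A *v v) \<ge> 0)"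

definition loewner_ge :: "real^'n^'n::finite \<Rightarrow> real^'n^'n \<Rightarrow> bool" where
  "loewner_ge A B \<longleftrightarrow> positive_semidefinite (A - B)"

definition riemannian_metric :: "(real^'n \<Rightarrow> real^'n^'n::finite) \<Rightarrow> bool" where
  "riemannian_metric M \<longleftrightarrow> (\<forall>x. positive_definite (M x))"

definition uniformly_positive_definite :: "(real^'n \<Rightarrow> real^'n^'n::finite) \<Rightarrow> bool" where
  "uniformly_positive_definite M \<longleftrightarrow> (\<exists>\<beta>>0. \<forall>x. loewner_ge (M x) (\<beta> *\<^sub>R mat 1))"

text \<open>\<open>christoffel M m i j x\<close> is the Christoffel symbol of the second kind with upper
  index \<open>m\<close> and lower indices \<open>i\<close>, \<open>j\<close>.\<close>

definition christoffel ::
  "(real^'n \<Rightarrow> real^'n^'n::finite) \<Rightarrow> 'n \<Rightarrow> 'n \<Rightarrow> 'n \<Rightarrow> real^'n \<Rightarrow> real" where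
  "christoffel M m i j x = 1 / 2 * (\<Sum>k\<in>UNIV. matrix_inv (M x) $ m $ k *
     (partial_deriv j (\<lambda>y. M y $ i $ k) x + partial_deriv i (\<lambda>y. M y $ j $ k) x
       - partial_deriv k (\<lambda>y. M y $ i $ j) x))"

definition riemannian_hessian ::
  "(real^'n \<Rightarrow> real^'n^'n::finite) \<Rightarrow> (real^'n \<Rightarrow> real) \<Rightarrow> real^'n \<Rightarrow> real^'n^'n" where
  "riemannian_hessian M f x = (\<chi> i j. partial_deriv i (partial_deriv j f) x
     - (\<Sum>k\<in>UNIV. christoffel M k i j x * partial_deriv k f x))"

definition geodesically_strongly_convex ::
  "real \<Rightarrow> (real^'n \<Rightarrow> real^'n^'n::finite) \<Rightarrow> (real^'n \<Rightarrow> real) \<Rightarrow> bool" where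
  "geodesically_strongly_convex \<alpha> M f \<longleftrightarrow>
     (\<forall>x. loewner_ge (riemannian_hessian M f x) (\<alpha> *\<^sub>R M x))"

definition nash_equilibrium :: "('a \<Rightarrow> 'b \<Rightarrow> real) \<Rightarrow> ('a \<Rightarrow> 'b \<Rightarrow> real) \<Rightarrow> 'a \<Rightarrow> 'b \<Rightarrow> bool" where
  "nash_equilibrium f1 f2 x1 x2 \<longleftrightarrow>
     (\<forall>y1. f1 x1 x2 \<le> f1 y1 x2) \<and> (\<forall>y2. f2 x1 x2 \<le> f2 x1 y2)"

definition natural_gradient_field ::
  "(real^'m::finite \<Rightarrow> real^'n::finite \<Rightarrow> real) \<Rightarrow> (real^'m \<Rightarrow> real^'n \<Rightarrow> real) \<Rightarrow>
   (real^'m \<Rightarrow> real^'m^'m) \<Rightarrow> (real^'n \<Rightarrow> real^'n^'n) \<Rightarrow>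
   (real^'m) \<times> (real^'n) \<Rightarrow> (real^'m) \<times> (real^'n)" where
  "natural_gradient_field f1 f2 M1 M2 = (\<lambda>(x1, x2).
     (- (matrix_inv (M1 x1) *v gradient (\<lambda>y1. f1 y1 x2) x1),
      - (matrix_inv (M2 x2) *v gradient (\<lambda>y2. f2 x1 y2) x2)))"

text \<open>Solutions live on \<open>[0, T)\<close> with \<open>0 < T \<le> \<infinity>\<close>. A trajectory is a solution that cannot be
  continued to a longer interval, so that a solution escaping in finite time also counts as a
  trajectory. Values of \<open>x\<close> outside \<open>[0, T)\<close> are irrelevant.\<close>

definition time_domain :: "ereal \<Rightarrow> real set" where
  "time_domain T = {t. 0 \<le> t \<and> ereal t < T}"

definition solution :: "('a::real_normed_vector \<Rightarrow> 'a) \<Rightarrow> ereal \<Rightarrow> (real \<Rightarrow> 'a) \<Rightarrow> bool" where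
  "solution F T x \<longleftrightarrow> 0 < T \<and>
     (\<forall>t\<in>time_domain T. (x has_vector_derivative F (x t)) (at t within time_domain T))"

definition trajectory :: "('a::real_normed_vector \<Rightarrow> 'a) \<Rightarrow> ereal \<Rightarrow> (real \<Rightarrow> 'a) \<Rightarrow> bool" where
  "trajectory F T x \<longleftrightarrow> solution F T x \<and>
     (\<nexists>T' y. T < T' \<and> solution F T' y \<and> (\<forall>t\<in>time_domain T. y t = x t))"

end

theory Submission
  imports Defs
begin

text \<open>
  Let \<open>G = diag(M1, k M2)\<close> be the product metric and \<open>F\<close> the field of the dynamics. The Lie
  derivative of \<open>G\<close> along \<open>F\<close> is \<open>- 2 (H1 + k H2)\<close>, because the mixed second derivatives cancel
  by scaled skew-symmetry; hence it is at most \<open>- c |v1|\<^sup>2\<close>. So the flow does not increase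
  Riemannian distances and strictly decreases them in the first component. The squared distance
  is taken as the infimum of the energies of curves, and only Euler steps \<open>\<gamma> + h F(\<gamma>)\<close> of nearly
  minimizing curves are compared, so neither geodesics nor a differentiable flow are needed.

  Along a bounded solution \<open>V = |F|\<^sup>2\<close>, measured in \<open>G\<close>, decreases with \<open>V' \<le> - c |F1|\<^sup>2\<close>. Since
  \<open>(k f2)' \<le> \<epsilon> + L |F1|\<^sup>2 - V\<close> for every \<open>\<epsilon>\<close> and a suitable \<open>L\<close>, the bounded quantity
  \<open>k f2 + (L / c) V\<close> has derivative at most \<open>\<epsilon> - V\<close>, which forces \<open>V \<rightarrow> 0\<close>. A cluster point is then
  an equilibrium, and the distance to it decreases to \<open>0\<close>. The distance of any other solution to
  this equilibrium decreases as well, so all solutions are bounded, and two equilibria agree in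
  the first component.
\<close>

section \<open>Continuously differentiable maps\<close>

text \<open>Because \<open>H2\<close> is only semidefinite, the decay of \<open>V\<close> sees
  \<open>F1\<close> alone, and \<open>k f2\<close> has to supply the missing part. As
  \<open>M2 F2 = - grad2 f2\<close>, along a solution
  \<open>(k f2)' = k (grad1 f2 . F1) + F1 . M1 F1 - V\<close>, and on a bounded set Young's
  inequality splits the first term into \<open>\<epsilon>\<close> and a multiple of
  \<open>|F1|^2\<close>. The functions are C2 and the metrics C1, so Christoffel symbols are merely
  continuous and geodesics need not be determined by their initial data; this is why distances enter
  as infima over curves. The price is an error \<open>o(h)\<close> in each step, made uniform over
  curves of bounded energy, so that the errors of many steps add up to an arbitrarily small amount.
  A zero of \<open>F\<close> must still be turned into a Nash equilibrium, that is, a critical point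
  into a global minimum for each player. The same variation of curves does this, applied to the
  player's own natural gradient field with the other strategy frozen: there the Lie derivative of
  the metric is \<open>- 2\<close> times the Riemannian Hessian. The bounded trajectory provides one
  equilibrium, and nonexpansion towards it also excludes escape in finite time.\<close>

definition has_C1_derivative ::
  "('a::euclidean_space \<Rightarrow> 'b::real_normed_vector) \<Rightarrow> ('a \<Rightarrow> 'a \<Rightarrow>\<^sub>L 'b) \<Rightarrow> bool" where
  "has_C1_derivative f f' \<longleftrightarrow>
     (\<forall>x. (f has_derivative blinfun_apply (f' x)) (at x)) \<and> continuous_on UNIV f'"

lemma C1_has_derivative:
  "has_C1_derivative f f' \<Longrightarrow> (f has_derivative blinfun_apply (f' x)) (at x within S)"
  unfolding has_C1_derivative_def by (blast intro: has_derivative_at_withinI)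

lemma C1_continuous_derivative: "has_C1_derivative f f' \<Longrightarrow> continuous_on S f'"
  unfolding has_C1_derivative_def by (blast intro: continuous_on_subset)

lemma C1_continuous: "has_C1_derivative f f' \<Longrightarrow> continuous_on S f"
  by (meson C1_has_derivative has_derivative_continuous_on)

lemma C1_bounded_linear:
  assumes "has_C1_derivative f f'" "bounded_linear L"
  shows "has_C1_derivative (\<lambda>x. L (f x)) (\<lambda>x. Blinfun L o\<^sub>L f' x)"
  unfolding has_C1_derivative_def
proof (intro conjI allI)
  fix x
  have "((\<lambda>x. L (f x)) has_derivative (\<lambda>v. L (f' x v))) (at x)"
    using bounded_linear.has_derivative[OF assms(2) C1_has_derivative[OF assms(1)]] .
  moreover have "blinfun_apply (Blinfun L o\<^sub>L f' x) = (\<lambda>v. L (f' x v))"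
    by (auto simp: bounded_linear_Blinfun_apply assms(2))
  ultimately show "((\<lambda>x. L (f x)) has_derivative blinfun_apply (Blinfun L o\<^sub>L f' x)) (at x)"
    by simp
  show "continuous_on UNIV (\<lambda>x. Blinfun L o\<^sub>L f' x)"
    by (intro continuous_intros C1_continuous_derivative[OF assms(1)])
qed

lemma C1_compose_affine:
  assumes "has_C1_derivative f f'" "bounded_linear L"
  shows "has_C1_derivative (\<lambda>x. f (a + L x)) (\<lambda>x. f' (a + L x) o\<^sub>L Blinfun L)"
  unfolding has_C1_derivative_def
proof (intro conjI allI)
  fix x
  have "((\<lambda>x. a + L x) has_derivative (\<lambda>v. 0 + L v)) (at x)"
    by (intro has_derivative_add has_derivative_const bounded_linear_imp_has_derivative assms)
  then have "((\<lambda>x. f (a + L x)) has_derivative (\<lambda>v. f' (a + L x) (0 + L v))) (at x)"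
    using C1_has_derivative[OF assms(1)] by (rule has_derivative_compose)
  moreover have "blinfun_apply (f' (a + L x) o\<^sub>L Blinfun L) = (\<lambda>v. f' (a + L x) (L v))"
    by (auto simp: bounded_linear_Blinfun_apply assms(2))
  ultimately show "((\<lambda>x. f (a + L x)) has_derivative blinfun_apply (f' (a + L x) o\<^sub>L Blinfun L)) (at x)"
    by simp
  have "continuous_on UNIV (\<lambda>x. f' (a + L x))"
    by (rule continuous_on_compose2[OF C1_continuous_derivative[OF assms(1), of UNIV]])
      (rule continuous_on_add[OF continuous_on_const linear_continuous_on[OF assms(2)]], simp)
  then show "continuous_on UNIV (\<lambda>x. f' (a + L x) o\<^sub>L Blinfun L)"
    by (intro continuous_intros)
qed

lemma C1_Pair:
  assumes "has_C1_derivative f f'" "has_C1_derivative g g'"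
  obtains h where "has_C1_derivative (\<lambda>x. (f x, g x)) h" "\<And>x v. h x v = (f' x v, g' x v)"
proof -
  define h where "h x = Blinfun (\<lambda>v. (f' x v, g' x v))" for x
  have *: "blinfun_apply (h x) = (\<lambda>v. (f' x v, g' x v))" for x
    unfolding h_def by (intro bounded_linear_Blinfun_apply bounded_linear_Pair blinfun.bounded_linear_right)
  have "has_C1_derivative (\<lambda>x. (f x, g x)) h"
    unfolding has_C1_derivative_def
  proof (intro conjI allI)
    show "((\<lambda>x. (f x, g x)) has_derivative blinfun_apply (h x)) (at x)" for x
      unfolding * by (intro has_derivative_Pair C1_has_derivative assms)
    show "continuous_on UNIV h"
      by (rule continuous_on_blinfun_componentwise)
        (auto simp: * intro!: continuous_intros C1_continuous_derivative assms)
  qed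
  with * show ?thesis using that by simp
qed

text \<open>The domain has a finite basis, so continuity of the partial derivatives is continuity of
  \<open>f'\<close> in operator norm.\<close>

lemma C_class_1_derivative:
  assumes "C_class 1 f"
  obtains f' where "has_C1_derivative f f'"
proof -
  define f' where "f' x = Blinfun (frechet_derivative f (at x))" for x
  have d: "(f has_derivative frechet_derivative f (at x)) (at x)" for x
    using assms by (simp add: frechet_derivative_works[symmetric])
  then have *: "blinfun_apply (f' x) = frechet_derivative f (at x)" for x
    unfolding f'_def by (intro bounded_linear_Blinfun_apply has_derivative_bounded_linear)
  have "has_C1_derivative f f'"
    unfolding has_C1_derivative_def * using d assms
    by (auto intro!: continuous_on_blinfun_componentwise simp: *)
  then show ?thesis by (rule that)
qed

text \<open>Taken over an arbitrary Euclidean space because it is applied to the joint cost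
  functions on the product of the two strategy spaces.\<close>

lemma C_class_2_gradient:
  fixes f :: "'a::euclidean_space \<Rightarrow> real"
  assumes "C_class 2 f"
  obtains g H where "\<And>x. (f has_derivative (\<lambda>v. g x \<bullet> v)) (at x)" "has_C1_derivative g H"
proof -
  define p where "p b x = frechet_derivative f (at x) b" for b x
  have C: "\<And>b. b \<in> Basis \<Longrightarrow> C_class 1 (p b)" and "\<And>x. f differentiable (at x)"
    using assms unfolding p_def numeral_2_eq_2 by auto
  then have d: "(f has_derivative frechet_derivative f (at x)) (at x)" for x
    by (simp add: frechet_derivative_works[symmetric])
  obtain P where P: "\<And>b. b \<in> Basis \<Longrightarrow> has_C1_derivative (p b) (P b)"
  proof -
    have "\<forall>b\<in>Basis. \<exists>P. has_C1_derivative (p b) P"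
      using C by (meson C_class_1_derivative)
    then show thesis using that by (metis bchoice)
  qed
  define g where "g x = (\<Sum>b\<in>Basis. p b x *\<^sub>R b)" for x
  define H where "H x = (\<Sum>b\<in>Basis. blinfun_scaleR_left b o\<^sub>L P b x)" for x
  have "frechet_derivative f (at x) = (\<lambda>v. g x \<bullet> v)" for x
  proof
    fix v
    interpret linear "frechet_derivative f (at x)"
      using d has_derivative_linear by blast
    have "frechet_derivative f (at x) v = frechet_derivative f (at x) (\<Sum>b\<in>Basis. (v \<bullet> b) *\<^sub>R b)"
      by (simp add: euclidean_representation)
    also have "\<dots> = (\<Sum>b\<in>Basis. (v \<bullet> b) * p b x)" by (simp add: sum scale p_def)
    also have "\<dots> = g x \<bullet> v" unfolding g_def inner_sum_left
      by (intro sum.cong) (auto simp: inner_commute)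
    finally show "frechet_derivative f (at x) v = g x \<bullet> v" .
  qed
  with d have "\<And>x. (f has_derivative (\<lambda>v. g x \<bullet> v)) (at x)" by metis
  moreover have "has_C1_derivative g H" unfolding has_C1_derivative_def
  proof (intro conjI allI)
    fix x
    have "(g has_derivative (\<lambda>v. \<Sum>b\<in>Basis. P b x v *\<^sub>R b)) (at x)"
      unfolding g_def
      by (rule has_derivative_sum) (rule has_derivative_scaleR_left[OF C1_has_derivative[OF P]])
    moreover have "blinfun_apply (H x) = (\<lambda>v. \<Sum>b\<in>Basis. P b x v *\<^sub>R b)"
      unfolding H_def by (auto simp: blinfun.sum_left)
    ultimately show "(g has_derivative blinfun_apply (H x)) (at x)" by simp
    show "continuous_on UNIV H"
      unfolding H_def by (intro continuous_intros C1_continuous_derivative[OF P])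
  qed
  ultimately show ?thesis by (rule that)
qed

text \<open>The mean value inequality for \<open>y \<mapsto> f y - f' x y\<close> on a small ball
  about \<open>x\<close>, with \<open>f'\<close> uniformly continuous on a larger ball. That
  \<open>y\<close> and \<open>z\<close> may both differ from \<open>x\<close> serves the second
  differences of a function; that one \<open>\<delta>\<close> works for all \<open>x\<close> in the
  ball serves the variation of curves.\<close>

lemma C1_uniform_expansion:
  assumes "has_C1_derivative f f'" "\<epsilon> > 0"
  obtains \<delta> where "\<delta> > 0"
    "\<And>x y z. norm x \<le> R \<Longrightarrow> dist x y \<le> \<delta> \<Longrightarrow> dist x z \<le> \<delta> \<Longrightarrow>
      norm (f y - f z - f' x (y - z)) \<le> \<epsilon> * norm (y - z)"
proof -
  have "uniformly_continuous_on (cball 0 (R + 1)) f'"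
    by (intro compact_uniformly_continuous C1_continuous_derivative[OF assms(1)]) auto
  then obtain d where d: "d > 0" "\<And>x y. x \<in> cball 0 (R + 1) \<Longrightarrow> y \<in> cball 0 (R + 1) \<Longrightarrow>
      dist x y < d \<Longrightarrow> dist (f' x) (f' y) < \<epsilon>"
    using assms(2) unfolding uniformly_continuous_on_def by blast
  show ?thesis
  \<comment> \<open>The \<open>1\<close> keeps the small balls inside radius \<open>R + 1\<close>;
    the half turns \<open>\<le>\<close> into the strict \<open>< d\<close>.\<close>
  proof (rule that[of "min 1 (d / 2)"])
    show "min 1 (d / 2) > 0" using d by auto
    fix x y z :: 'a
    assume x: "norm x \<le> R" and yz: "dist x y \<le> min 1 (d / 2)" "dist x z \<le> min 1 (d / 2)"
    let ?S = "cball x (min 1 (d / 2))"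
    have "norm ((f y - f' x y) - (f z - f' x z)) \<le> \<epsilon> * norm (y - z)"
    proof (rule differentiable_bound[of ?S])
      show "((\<lambda>y. f y - f' x y) has_derivative (f' u - f' x)) (at u within ?S)" for u
        by (auto intro!: derivative_eq_intros C1_has_derivative[OF assms(1)] simp: blinfun.diff_left)
      fix u assume u: "u \<in> ?S"
      have "norm u \<le> norm x + norm (u - x)"
        using norm_triangle_ineq[of x "u - x"] by simp
      then have "norm u \<le> R + 1" using u x by (auto simp: dist_norm norm_minus_commute)
      then have "dist (f' u) (f' x) < \<epsilon>" using u x d(1)
        by (intro d(2)) (auto simp: dist_commute)
      then show "onorm (f' u - f' x) \<le> \<epsilon>"
        by (simp add: dist_norm norm_blinfun.rep_eq)
    qed (use yz in auto)
    then show "norm (f y - f z - f' x (y - z)) \<le> \<epsilon> * norm (y - z)"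
      by (simp add: blinfun.diff_right algebra_simps)
  qed
qed

text \<open>Schwarz's theorem: the second difference of \<open>f\<close> over the parallelogram
  spanned by \<open>s v\<close> and \<open>s w\<close> is symmetric in \<open>v\<close> and
  \<open>w\<close>, and it equals \<open>s^2 (H x v \<bullet> w)\<close> up to
  \<open>\<epsilon> s^2 |v| |w|\<close>.\<close>

lemma gradient_derivative_symmetric:
  fixes f :: "'a::euclidean_space \<Rightarrow> real"
  assumes f: "\<And>x. (f has_derivative (\<lambda>v. g x \<bullet> v)) (at x)" and g: "has_C1_derivative g H"
  shows "H x v \<bullet> w = H x w \<bullet> v"
proof -
  have "\<bar>H x v \<bullet> w - H x w \<bullet> v\<bar> \<le> 0 + e" if "e > 0" for e
  proof -
    define \<epsilon> where "\<epsilon> = e / (2 * (norm v * norm w + 1))"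
    have pos: "norm v * norm w + 1 > 0" by (simp add: add_nonneg_pos)
    have "\<epsilon> > 0" using that pos by (simp add: \<epsilon>_def)
    obtain \<delta> where \<delta>: "\<delta> > 0" "\<And>y z. dist x y \<le> \<delta> \<Longrightarrow> dist x z \<le> \<delta> \<Longrightarrow>
      norm (g y - g z - H x (y - z)) \<le> \<epsilon> * norm (y - z)"
      using C1_uniform_expansion[OF g \<open>\<epsilon> > 0\<close>, of "norm x"] by (metis order.refl)
    define s where "s = \<delta> / (norm v + norm w + 1)"
    have "norm v + norm w + 1 > 0" by (simp add: add_nonneg_pos)
    then have s: "s > 0" "s * (norm v + norm w + 1) = \<delta>"
      using \<delta>(1) by (auto simp: s_def)
    then have s: "s > 0" "s * norm v + s * norm w \<le> \<delta>"
      by (auto simp: algebra_simps)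
    define \<Delta> where "\<Delta> v w = f (x + s *\<^sub>R v + s *\<^sub>R w) - f (x + s *\<^sub>R w) - f (x + s *\<^sub>R v) + f x" for v w
    \<comment> \<open>One mean value step in direction \<open>w\<close> leaves a difference of
      gradients at two points that are offset by \<open>s v\<close> and within
      \<open>\<delta>\<close> of \<open>x\<close>. The estimate is stated for fresh
      \<open>v\<close>, \<open>w\<close> since it is applied in both orders.\<close>
    have main: "\<bar>\<Delta> v w - s\<^sup>2 * (H x v \<bullet> w)\<bar> \<le> s\<^sup>2 * (\<epsilon> * (norm v * norm w))"
      if vw: "s * norm v + s * norm w \<le> \<delta>" for v w
    proof -
      define \<psi> where "\<psi> t = f (x + s *\<^sub>R v + t *\<^sub>R w) - f (x + t *\<^sub>R w)" for t
      define \<psi>' where "\<psi>' t = (g (x + s *\<^sub>R v + t *\<^sub>R w) - g (x + t *\<^sub>R w)) \<bullet> w" for t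
      have "(\<psi> has_real_derivative \<psi>' t) (at t)" for t
      proof -
        have "(\<psi> has_derivative (\<lambda>h. g (x + s *\<^sub>R v + t *\<^sub>R w) \<bullet> (h *\<^sub>R w) - g (x + t *\<^sub>R w) \<bullet> (h *\<^sub>R w))) (at t)"
          unfolding \<psi>_def
          by (intro has_derivative_diff has_derivative_compose[OF _ f]) (auto intro!: derivative_eq_intros)
        then show ?thesis
          by (rule has_derivative_imp_has_field_derivative) (simp add: \<psi>'_def inner_diff_left algebra_simps)
      qed
      then obtain \<xi> where \<xi>: "0 < \<xi>" "\<xi> < s" "\<psi> s - \<psi> 0 = (s - 0) * \<psi>' \<xi>"
        using MVT2[of 0 s \<psi> \<psi>'] s by blast
      have \<xi>w: "\<xi> * norm w \<le> s * norm w" using \<xi> by (simp add: mult_right_mono)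
      have "norm (s *\<^sub>R v + \<xi> *\<^sub>R w) \<le> s * norm v + s * norm w"
        using norm_triangle_ineq[of "s *\<^sub>R v" "\<xi> *\<^sub>R w"] \<xi>w \<xi> s by simp
      then have 1: "norm (\<xi> *\<^sub>R w + s *\<^sub>R v) \<le> \<delta>" using vw by (simp add: add.commute)
      have "s * norm v \<ge> 0" using s by simp
      with vw \<xi>w have 2: "\<xi> * norm w \<le> \<delta>" by linarith
      have "norm (g (x + s *\<^sub>R v + \<xi> *\<^sub>R w) - g (x + \<xi> *\<^sub>R w)
         - H x ((x + s *\<^sub>R v + \<xi> *\<^sub>R w) - (x + \<xi> *\<^sub>R w)))
         \<le> \<epsilon> * norm ((x + s *\<^sub>R v + \<xi> *\<^sub>R w) - (x + \<xi> *\<^sub>R w))"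
        using 1 2 \<xi> by (intro \<delta>) (auto simp: dist_norm norm_minus_commute add_ac)
      then have *: "norm (g (x + s *\<^sub>R v + \<xi> *\<^sub>R w) - g (x + \<xi> *\<^sub>R w) - s *\<^sub>R H x v) \<le> \<epsilon> * (s * norm v)"
        using s by (simp add: blinfun.scaleR_right)
      have "\<psi>' \<xi> - s * (H x v \<bullet> w) = (g (x + s *\<^sub>R v + \<xi> *\<^sub>R w) - g (x + \<xi> *\<^sub>R w) - s *\<^sub>R H x v) \<bullet> w"
        by (simp add: \<psi>'_def inner_diff_left)
      then have "\<bar>\<psi>' \<xi> - s * (H x v \<bullet> w)\<bar> \<le> (\<epsilon> * (s * norm v)) * norm w"
        using Cauchy_Schwarz_ineq2[of "g (x + s *\<^sub>R v + \<xi> *\<^sub>R w) - g (x + \<xi> *\<^sub>R w) - s *\<^sub>R H x v" w]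
          mult_right_mono[OF * norm_ge_zero[of w]] by linarith
      then have "s * \<bar>\<psi>' \<xi> - s * (H x v \<bullet> w)\<bar> \<le> s * ((\<epsilon> * (s * norm v)) * norm w)"
        using s by (intro mult_left_mono) auto
      moreover have "\<Delta> v w - s\<^sup>2 * (H x v \<bullet> w) = s * (\<psi>' \<xi> - s * (H x v \<bullet> w))"
        using \<xi>(3) unfolding \<Delta>_def \<psi>_def by (simp add: algebra_simps power2_eq_square)
      ultimately have "\<bar>\<Delta> v w - s\<^sup>2 * (H x v \<bullet> w)\<bar> \<le> s * ((\<epsilon> * (s * norm v)) * norm w)"
        using s by (simp only: abs_mult)
      also have "\<dots> = s\<^sup>2 * (\<epsilon> * (norm v * norm w))" by (simp add: power2_eq_square)
      finally show ?thesis .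
    qed
    have "\<Delta> v w = \<Delta> w v" unfolding \<Delta>_def by (simp add: add.commute add.left_commute)
    with main[of v w] main[of w v] s(2)
    have "\<bar>s\<^sup>2 * (H x v \<bullet> w) - s\<^sup>2 * (H x w \<bullet> v)\<bar> \<le> 2 * (s\<^sup>2 * (\<epsilon> * (norm v * norm w)))"
      by (simp add: algebra_simps)
    then have "s\<^sup>2 * \<bar>H x v \<bullet> w - H x w \<bullet> v\<bar> \<le> s\<^sup>2 * (2 * \<epsilon> * (norm v * norm w))"
      by (simp add: right_diff_distrib[symmetric] abs_mult mult_ac)
    then have "\<bar>H x v \<bullet> w - H x w \<bullet> v\<bar> \<le> 2 * \<epsilon> * (norm v * norm w)"
      using s by simp
    also have "\<dots> = e * ((norm v * norm w) / (norm v * norm w + 1))"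
      using pos by (simp add: \<epsilon>_def field_simps)
    also have "\<dots> \<le> e * 1" using that pos by (intro mult_left_mono) auto
    finally show ?thesis by simp
  qed
  then have "\<bar>H x v \<bullet> w - H x w \<bullet> v\<bar> \<le> 0" by (rule field_le_epsilon)
  then show ?thesis by simp
qed

section \<open>Linear systems with a coercive matrix\<close>

lemma coercive_norm_le:
  fixes G :: "'a::euclidean_space \<Rightarrow>\<^sub>L 'a"
  assumes "\<And>v. \<beta> * (norm v)\<^sup>2 \<le> v \<bullet> G v"
  shows "\<beta> * norm v \<le> norm (G v)"
proof (cases "v = 0")
  case False
  have "\<beta> * norm v * norm v \<le> norm (G v) * norm v"
    using assms[of v] Cauchy_Schwarz_ineq2[of v "G v"] by (simp add: power2_eq_square mult_ac)
  then show ?thesis using False by simp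
qed simp

text \<open>\<open>G y (u y - u x) = r y - G y (u x)\<close>, and the right side tends to
  \<open>0\<close> as \<open>y\<close> tends to \<open>x\<close>. The coercivity constant does not
  depend on \<open>y\<close>, so the smallness passes to \<open>u y - u x\<close>.\<close>

lemma coercive_solution_continuous:
  fixes G :: "'b::t2_space \<Rightarrow> 'a::euclidean_space \<Rightarrow>\<^sub>L 'a"
  assumes "\<beta> > 0" and coercive: "\<And>x v. \<beta> * (norm v)\<^sup>2 \<le> v \<bullet> G x v"
    and "continuous_on UNIV G" "continuous_on UNIV r" and u: "\<And>x. G x (u x) = r x"
  shows "continuous_on UNIV u"
proof -
  have "isCont u x" for x
  proof -
    have "((\<lambda>y. r y - G y (u x)) \<longlongrightarrow> r x - G x (u x)) (at x)"
      using assms(3,4) by (intro tendsto_intros) (auto simp: continuous_on_def)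
    then have 1: "((\<lambda>y. norm (r y - G y (u x)) / \<beta>) \<longlongrightarrow> 0) (at x)"
      using tendsto_divide[OF tendsto_norm tendsto_const[of \<beta>]] \<open>\<beta> > 0\<close> by (fastforce simp: u)
    have "norm (u y - u x) \<le> norm (r y - G y (u x)) / \<beta>" for y
      using coercive_norm_le[OF coercive, of "u y - u x" y] \<open>\<beta> > 0\<close>
      by (simp add: blinfun.diff_right u field_simps)
    then have "((\<lambda>y. u y - u x) \<longlongrightarrow> 0) (at x)"
      by (intro Lim_null_comparison[OF _ 1]) auto
    then show ?thesis by (simp add: isCont_def LIM_zero_iff)
  qed
  then show ?thesis by (simp add: continuous_at_imp_continuous_on)
qed

lemma coercive_solvable:
  fixes G :: "'a::euclidean_space \<Rightarrow>\<^sub>L 'a"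
  assumes "\<beta> > 0" and coercive: "\<And>v. \<beta> * (norm v)\<^sup>2 \<le> v \<bullet> G v"
  obtains N :: "'a \<Rightarrow>\<^sub>L 'a" where "\<And>v. G (N v) = v" "\<And>v. N (G v) = v"
proof -
  have lin: "linear (blinfun_apply G)" by (simp add: blinfun.bounded_linear_right bounded_linear.linear)
  have "inj (blinfun_apply G)"
  proof (subst linear_injective_0[OF lin], safe)
    fix v assume "G v = 0"
    then show "v = 0" using coercive_norm_le[OF coercive, of v] \<open>\<beta> > 0\<close>
      by (simp add: mult_le_0_iff)
  qed
  then obtain n where "linear n" "\<And>v. n (G v) = v" "\<And>v. G (n v) = v"
    using linear_injective_isomorphism[OF lin] by metis
  then show ?thesis using that[of "Blinfun n"]
    by (simp add: bounded_linear_Blinfun_apply linear_conv_bounded_linear)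
qed

text \<open>Implicit differentiation of \<open>G x (u x) = b x\<close>. With \<open>u\<close> the
  natural gradient field, the formula for \<open>G x (u' x v)\<close> is just the expression that
  enters the Lie derivative of the metric, so the matrix inverse itself is never
  differentiated.\<close>

lemma coercive_solution_C1:
  fixes G :: "'a::euclidean_space \<Rightarrow> 'b::euclidean_space \<Rightarrow>\<^sub>L 'b"
  assumes "\<beta> > 0" and coercive: "\<And>x v. \<beta> * (norm v)\<^sup>2 \<le> v \<bullet> G x v"
    and G: "has_C1_derivative G G'" and b: "has_C1_derivative b b'" and u: "\<And>x. G x (u x) = b x"
  obtains u' where "has_C1_derivative u u'" "\<And>x v. G x (u' x v) = b' x v - G' x v (u x)"
proof -
  have "\<exists>N :: 'b \<Rightarrow>\<^sub>L 'b. (\<forall>v. G x (N v) = v) \<and> (\<forall>v. N (G x v) = v)" for x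
    using coercive_solvable[OF \<open>\<beta> > 0\<close> coercive] by metis
  then obtain N :: "'a \<Rightarrow> 'b \<Rightarrow>\<^sub>L 'b" where N: "\<And>x v. G x (N x v) = v" "\<And>x v. N x (G x v) = v"
    by metis
  define u' where "u' x = Blinfun (\<lambda>v. N x (b' x v - G' x v (u x)))" for x
  have "bounded_linear (\<lambda>v. N x (b' x v - G' x v (u x)))" for x
    by (intro bounded_linear_intros)
  then have u': "blinfun_apply (u' x) = (\<lambda>v. N x (b' x v - G' x v (u x)))" for x
    unfolding u'_def by (intro bounded_linear_Blinfun_apply)
  have cont_u: "continuous_on UNIV u"
    using coercive_solution_continuous[OF \<open>\<beta> > 0\<close> coercive C1_continuous[OF G] C1_continuous[OF b] u] .
  have cont_u': "continuous_on UNIV u'"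
  proof (rule continuous_on_blinfun_componentwise)
    fix i :: 'a
    show "continuous_on UNIV (\<lambda>x. u' x i)"
      by (rule coercive_solution_continuous[OF \<open>\<beta> > 0\<close> coercive C1_continuous[OF G],
            where r = "\<lambda>x. b' x i - G' x i (u x)"])
        (auto simp: u' N intro!: continuous_intros C1_continuous_derivative[OF G]
          C1_continuous_derivative[OF b] cont_u)
  qed
  have "(u has_derivative blinfun_apply (u' x)) (at x)" for x
  proof -
    \<comment> \<open>A product of two increments: the first is \<open>O(|y - x|)\<close>, the
      second tends to \<open>0\<close> by continuity of \<open>u\<close>.\<close>
    have small: "((\<lambda>y. (G y - G x) (u y - u x)) has_derivative (\<lambda>v. 0)) (at x)"
    proof -
      obtain K where K: "\<And>v. norm (G' x v) \<le> norm v * K"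
        using blinfun.bounded_linear_right[of "G' x"] bounded_linear.bounded by blast
      have e: "\<forall>\<^sub>F y in at x. norm (G y - G x) \<le> (\<bar>K\<bar> + 1) * norm (y - x)"
      proof -
        from C1_has_derivative[OF G, of x UNIV] obtain d where d: "d > 0"
          "\<And>y. norm (y - x) < d \<Longrightarrow> norm (G y - G x - G' x (y - x)) \<le> 1 * norm (y - x)"
          unfolding has_derivative_at_alt using zero_less_one by blast
        have "norm (G y - G x) \<le> (\<bar>K\<bar> + 1) * norm (y - x)" if "dist y x < d" for y
        proof -
          have "norm (G y - G x) \<le> norm (G y - G x - G' x (y - x)) + norm (G' x (y - x))"
            using norm_triangle_ineq[of "G y - G x - G' x (y - x)" "G' x (y - x)"] by simp
          also have "\<dots> \<le> 1 * norm (y - x) + norm (y - x) * \<bar>K\<bar>"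
            using d(2)[of y] that K[of "y - x"]
            by (intro add_mono) (auto simp: dist_norm intro: order_trans[OF _ mult_left_mono])
          finally show ?thesis by (simp add: algebra_simps)
        qed
        then show ?thesis unfolding eventually_at using d(1) by blast
      qed
      have "((\<lambda>y. (\<bar>K\<bar> + 1) * norm (u y - u x)) \<longlongrightarrow> (\<bar>K\<bar> + 1) * norm (u x - u x)) (at x)"
        using cont_u by (intro tendsto_intros) (auto simp: continuous_on_def)
      then have 1: "((\<lambda>y. (\<bar>K\<bar> + 1) * norm (u y - u x)) \<longlongrightarrow> 0) (at x)" by simp
      have "((\<lambda>y. norm ((G y - G x) (u y - u x)) / norm (y - x)) \<longlongrightarrow> 0) (at x)"
      proof (rule Lim_null_comparison[OF _ 1])
        show "\<forall>\<^sub>F y in at x. norm (norm ((G y - G x) (u y - u x)) / norm (y - x))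
            \<le> (\<bar>K\<bar> + 1) * norm (u y - u x)"
          using e eventually_neq_at_within[of x x UNIV]
        proof eventually_elim
          case (elim y)
          have "norm ((G y - G x) (u y - u x)) \<le> norm (G y - G x) * norm (u y - u x)"
            by (rule norm_blinfun)
          also have "\<dots> \<le> ((\<bar>K\<bar> + 1) * norm (y - x)) * norm (u y - u x)"
            using elim by (intro mult_right_mono) auto
          finally show ?case using elim by (simp add: field_simps)
        qed
      qed
      then show ?thesis unfolding has_derivative_iff_norm by simp
    qed
    \<comment> \<open>This difference is exactly \<open>G x (u y - u x)\<close>; applying
      \<open>N x\<close> recovers \<open>u y\<close> from terms whose derivative at \<open>x\<close>
      is known.\<close>
    have "((\<lambda>y. b y - b x - (G y - G x) (u x) - (G y - G x) (u y - u x)) has_derivative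
       (\<lambda>v. b' x v - 0 - (G' x v - 0) (u x) - 0)) (at x)"
      by (intro has_derivative_diff C1_has_derivative[OF b] C1_has_derivative[OF G] has_derivative_const small
          bounded_linear.has_derivative[OF blinfun.bounded_linear_left])
    then have "((\<lambda>y. u x + N x (b y - b x - (G y - G x) (u x) - (G y - G x) (u y - u x))) has_derivative
       (\<lambda>v. 0 + N x (b' x v - 0 - (G' x v - 0) (u x) - 0))) (at x)"
      by (intro has_derivative_add has_derivative_const
          bounded_linear.has_derivative[OF blinfun.bounded_linear_right])
    moreover have "u x + N x (b y - b x - (G y - G x) (u x) - (G y - G x) (u y - u x)) = u y" for y
    proof -
      have "b y - b x - (G y - G x) (u x) - (G y - G x) (u y - u x) = G x (u y - u x)"
        unfolding u[symmetric] by (simp add: blinfun.bilinear_simps)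
      then show ?thesis by (simp add: N)
    qed
    ultimately show ?thesis unfolding u' by simp
  qed
  with cont_u' have "has_C1_derivative u u'" unfolding has_C1_derivative_def by blast
  then show ?thesis by (rule that) (simp add: u' N)
qed

section \<open>Energy of curves and its first variation\<close>

text \<open>Integrate \<open>0 \<le> |f s - m|^2\<close>, where \<open>m\<close> is the mean of
  \<open>f\<close>.\<close>

lemma norm_integral_squared_le:
  fixes f :: "real \<Rightarrow> 'a::euclidean_space"
  assumes f: "continuous_on {0..1} f"
  shows "(norm (integral {0..1} f))\<^sup>2 \<le> integral {0..1} (\<lambda>s. (norm (f s))\<^sup>2)"
proof -
  define m where "m = integral {0..1} f"
  have i: "(f has_integral m) {0..1}"
    unfolding m_def using f by (intro integrable_integral integrable_continuous_interval)
  have n: "((\<lambda>s. (norm (f s))\<^sup>2) has_integral integral {0..1} (\<lambda>s. (norm (f s))\<^sup>2)) {0..1}"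
    using f by (intro integrable_integral integrable_continuous_interval continuous_intros)
  have "((\<lambda>s. m \<bullet> f s) has_integral m \<bullet> m) {0..1}"
    using has_integral_linear[OF i bounded_linear_inner_right[of m]] by (simp add: o_def)
  then have "((\<lambda>s. (norm (f s))\<^sup>2 - 2 * (m \<bullet> f s) + (norm m)\<^sup>2) has_integral
      (integral {0..1} (\<lambda>s. (norm (f s))\<^sup>2) - 2 * (m \<bullet> m) + (norm m)\<^sup>2)) {0..1}"
    using has_integral_const_real[of "(norm m)\<^sup>2" 0 1]
    by (intro has_integral_add has_integral_diff has_integral_mult_right n) auto
  then have "0 \<le> integral {0..1} (\<lambda>s. (norm (f s))\<^sup>2) - 2 * (m \<bullet> m) + (norm m)\<^sup>2"
  proof (rule has_integral_nonneg)
    fix s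
    have "(norm (f s))\<^sup>2 - 2 * (m \<bullet> f s) + (norm m)\<^sup>2 = (norm (f s - m))\<^sup>2"
      by (simp add: power2_norm_eq_inner inner_diff_left inner_diff_right inner_commute)
    then show "0 \<le> (norm (f s))\<^sup>2 - 2 * (m \<bullet> f s) + (norm m)\<^sup>2" by simp
  qed
  then show ?thesis unfolding m_def[symmetric] by (simp add: power2_norm_eq_inner)
qed

lemma inner_blinfun_le:
  fixes B :: "'a::real_inner \<Rightarrow>\<^sub>L 'a"
  assumes "norm a \<le> a'" "norm B \<le> b" "norm c \<le> c'"
  shows "a \<bullet> B c \<le> a' * (b * c')"
proof -
  have "a \<bullet> B c \<le> norm a * norm (B c)" by (rule norm_cauchy_schwarz)
  also have "\<dots> \<le> norm a * (norm B * norm c)" by (intro mult_left_mono norm_blinfun) auto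
  also have "\<dots> \<le> a' * (b * c')"
    using assms by (intro mult_mono) (auto intro: order_trans[OF norm_ge_zero])
  finally show ?thesis .
qed

text \<open>The velocity is carried along as an argument, with one-sided derivatives at the ends, so
  that energies are plain integrals over \<open>{0..1}\<close> and values outside this interval are
  irrelevant.\<close>

definition curve :: "'a::real_normed_vector \<Rightarrow> 'a \<Rightarrow> (real \<Rightarrow> 'a) \<Rightarrow> (real \<Rightarrow> 'a) \<Rightarrow> bool" where
  "curve p q \<gamma> \<gamma>' \<longleftrightarrow> \<gamma> 0 = p \<and> \<gamma> 1 = q \<and> continuous_on {0..1} \<gamma>' \<and>
     (\<forall>s\<in>{0..1}. (\<gamma> has_vector_derivative \<gamma>' s) (at s within {0..1}))"

lemma curve_continuous: "curve p q \<gamma> \<gamma>' \<Longrightarrow> continuous_on {0..1} \<gamma>"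
  unfolding curve_def by (meson continuous_on_vector_derivative)

lemma curve_continuous_derivative: "curve p q \<gamma> \<gamma>' \<Longrightarrow> continuous_on {0..1} \<gamma>'"
  unfolding curve_def by simp

lemma curve_integral:
  fixes p :: "'a::euclidean_space"
  assumes "curve p q \<gamma> \<gamma>'"
  shows "(\<gamma>' has_integral (q - p)) {0..1}"
  using fundamental_theorem_of_calculus[of 0 1 \<gamma> \<gamma>'] assms unfolding curve_def by auto

lemma curve_line: "curve p q (\<lambda>s. p + s *\<^sub>R (q - p)) (\<lambda>s. q - p)"
  unfolding curve_def by (auto intro!: derivative_eq_intros)

text \<open>Kept apart from the game because it is used for two kinds of field: the joint dynamics
  in the product metric, and the natural gradient field of a single player. The global bound
  \<open>\<beta>\<close> is what confines curves of bounded energy.\<close>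

locale riemannian_field =
  fixes G :: "'a::euclidean_space \<Rightarrow> 'a \<Rightarrow>\<^sub>L 'a" and G' :: "'a \<Rightarrow> 'a \<Rightarrow>\<^sub>L 'a \<Rightarrow>\<^sub>L 'a"
    and F :: "'a \<Rightarrow> 'a" and F' :: "'a \<Rightarrow> 'a \<Rightarrow>\<^sub>L 'a" and \<beta> :: real
  assumes metric_C1: "has_C1_derivative G G'"
    and field_C1: "has_C1_derivative F F'"
    and symmetric: "v \<bullet> G x w = w \<bullet> G x v"
    and beta_pos: "\<beta> > 0"
    and coercive: "\<beta> * (norm v)\<^sup>2 \<le> v \<bullet> G x v"
begin

text \<open>The Lie derivative of the metric along the field, as a quadratic form.\<close>

definition rate :: "'a \<Rightarrow> 'a \<Rightarrow> real" where
  "rate x v = v \<bullet> G' x (F x) v + 2 * (v \<bullet> G x (F' x v))"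

definition energy :: "(real \<Rightarrow> 'a) \<Rightarrow> (real \<Rightarrow> 'a) \<Rightarrow> real" where
  "energy \<gamma> \<gamma>' = integral {0..1} (\<lambda>s. \<gamma>' s \<bullet> G (\<gamma> s) (\<gamma>' s))"

text \<open>The square of the Riemannian distance.\<close>

definition min_energy :: "'a \<Rightarrow> 'a \<Rightarrow> real" where
  "min_energy p q = Inf {energy \<gamma> \<gamma>' |\<gamma> \<gamma>'. curve p q \<gamma> \<gamma>'}"

lemma metric_nonneg: "0 \<le> v \<bullet> G x v"
  using coercive[of v x] beta_pos by (meson mult_nonneg_nonneg less_imp_le order_trans zero_le_power2)

lemma continuous_on_compose_C1:
  assumes "continuous_on S g"
  shows "continuous_on S (\<lambda>s. G (g s))" "continuous_on S (\<lambda>s. F (g s))"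
    "continuous_on S (\<lambda>s. F' (g s))" "continuous_on S (\<lambda>s. G' (g s))"
  by (rule continuous_on_compose2[OF _ assms subset_UNIV],
      simp add: C1_continuous[OF metric_C1] C1_continuous[OF field_C1]
        C1_continuous_derivative[OF metric_C1] C1_continuous_derivative[OF field_C1])+

lemmas curve_intros = continuous_intros continuous_on_compose_C1

lemma energy_has_integral:
  assumes "curve p q \<gamma> \<gamma>'"
  shows "((\<lambda>s. \<gamma>' s \<bullet> G (\<gamma> s) (\<gamma>' s)) has_integral energy \<gamma> \<gamma>') {0..1}"
  unfolding energy_def
  by (intro integrable_integral integrable_continuous_interval curve_intros
      curve_continuous[OF assms] curve_continuous_derivative[OF assms])

lemma energy_nonneg: "curve p q \<gamma> \<gamma>' \<Longrightarrow> 0 \<le> energy \<gamma> \<gamma>'"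
  using has_integral_nonneg[OF energy_has_integral] metric_nonneg by blast

lemma min_energy_le: "curve p q \<gamma> \<gamma>' \<Longrightarrow> min_energy p q \<le> energy \<gamma> \<gamma>'"
  unfolding min_energy_def
  by (rule cInf_lower) (auto intro!: bdd_belowI[where m = 0] energy_nonneg)

lemma min_energy_greatest:
  assumes "\<And>\<gamma> \<gamma>'. curve p q \<gamma> \<gamma>' \<Longrightarrow> m \<le> energy \<gamma> \<gamma>'"
  shows "m \<le> min_energy p q"
  unfolding min_energy_def using curve_line assms by (intro cInf_greatest) auto

lemma min_energy_approx:
  assumes "\<eta> > 0"
  obtains \<gamma> \<gamma>' where "curve p q \<gamma> \<gamma>'" "energy \<gamma> \<gamma>' < min_energy p q + \<eta>"
proof -
  have "\<exists>\<gamma> \<gamma>'. curve p q \<gamma> \<gamma>' \<and> energy \<gamma> \<gamma>' < min_energy p q + \<eta>"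
  proof (rule ccontr)
    assume "\<not> ?thesis"
    then have "min_energy p q + \<eta> \<le> min_energy p q"
      by (intro min_energy_greatest) (auto simp: not_less)
    then show False using assms by simp
  qed
  then show ?thesis using that by blast
qed

lemma speed_integral_le:
  assumes c: "curve p q \<gamma> \<gamma>'"
  shows "integral {0..1} (\<lambda>s. (norm (\<gamma>' s))\<^sup>2) \<le> energy \<gamma> \<gamma>' / \<beta>"
proof -
  have "integral {0..1} (\<lambda>s. (norm (\<gamma>' s))\<^sup>2) \<le> integral {0..1} (\<lambda>s. (\<gamma>' s \<bullet> G (\<gamma> s) (\<gamma>' s)) / \<beta>)"
  proof (rule integral_le)
    show "(norm (\<gamma>' s))\<^sup>2 \<le> \<gamma>' s \<bullet> G (\<gamma> s) (\<gamma>' s) / \<beta>" for s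
      using coercive[of "\<gamma>' s" "\<gamma> s"] beta_pos by (simp add: field_simps)
  qed (use beta_pos in \<open>auto intro!: integrable_continuous_interval curve_intros
    curve_continuous[OF c] curve_continuous_derivative[OF c]\<close>)
  then show ?thesis by (simp add: energy_def)
qed

text \<open>The displacement is the integral of the velocity. In consequence the sublevel sets of
  \<open>min_energy p\<close> are bounded.\<close>

lemma norm_diff_le_min_energy: "\<beta> * (norm (q - p))\<^sup>2 \<le> min_energy p q"
proof (rule min_energy_greatest)
  fix \<gamma> \<gamma>' :: "real \<Rightarrow> 'a" assume c: "curve p q \<gamma> \<gamma>'"
  have "(norm (q - p))\<^sup>2 \<le> energy \<gamma> \<gamma>' / \<beta>"
    using norm_integral_squared_le[OF curve_continuous_derivative[OF c]] speed_integral_le[OF c]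
    by (simp add: integral_unique[OF curve_integral[OF c]])
  then show "\<beta> * (norm (q - p))\<^sup>2 \<le> energy \<gamma> \<gamma>'"
    using beta_pos by (simp add: field_simps)
qed

text \<open>The segment from \<open>p\<close> to \<open>q\<close> stays in the ball and competes in
  the infimum. Together with the opposite bound, smallness of \<open>min_energy\<close> means
  Euclidean closeness.\<close>

lemma min_energy_le_norm:
  assumes "norm p \<le> R" "norm q \<le> R" "\<And>x. norm x \<le> R \<Longrightarrow> norm (G x) \<le> K"
  shows "min_energy p q \<le> K * (norm (q - p))\<^sup>2"
proof -
  have "energy (\<lambda>s. p + s *\<^sub>R (q - p)) (\<lambda>s. q - p) \<le> integral {0..1} (\<lambda>s::real. K * (norm (q - p))\<^sup>2)"
    unfolding energy_def
  proof (rule integral_le)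
    fix s :: real assume s: "s \<in> {0..1}"
    have "p + s *\<^sub>R (q - p) \<in> cball 0 R"
      using convexD_alt[OF convex_cball, of p 0 R q s] assms(1,2) s by (simp add: algebra_simps)
    then have "norm (G (p + s *\<^sub>R (q - p))) \<le> K" by (intro assms(3)) simp
    then have "(q - p) \<bullet> G (p + s *\<^sub>R (q - p)) (q - p) \<le> norm (q - p) * (K * norm (q - p))"
      by (intro inner_blinfun_le) auto
    then show "(q - p) \<bullet> G (p + s *\<^sub>R (q - p)) (q - p) \<le> K * (norm (q - p))\<^sup>2"
      by (simp add: power2_eq_square mult_ac)
  qed (auto intro!: integrable_continuous_interval curve_intros)
  then show ?thesis using min_energy_le[OF curve_line, of p q] by simp
qed

text \<open>Confines all curves of bounded energy starting at \<open>p\<close> to one ball, on which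
  the metric, the field and their derivatives have uniform bounds. The crude
  \<open>|v| \<le> 1 + |v|^2\<close> is enough to bound the length.\<close>

lemma curve_norm_le:
  assumes c: "curve p q \<gamma> \<gamma>'" and s: "s \<in> {0..1}"
  shows "norm (\<gamma> s) \<le> norm p + 1 + energy \<gamma> \<gamma>' / \<beta>"
proof -
  have int: "(\<lambda>s. 1 + (norm (\<gamma>' s))\<^sup>2) integrable_on {0..1}" "(\<lambda>s. (norm (\<gamma>' s))\<^sup>2) integrable_on {0..1}"
    by (intro integrable_continuous_interval curve_intros
        curve_continuous[OF c] curve_continuous_derivative[OF c])+
  have sub: "(\<lambda>s. 1 + (norm (\<gamma>' s))\<^sup>2) integrable_on {0..s}"
    using integrable_subinterval_real[OF int(1)] s by auto
  have "(\<gamma>' has_integral (\<gamma> s - \<gamma> 0)) {0..s}"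
  proof (rule fundamental_theorem_of_calculus)
    fix t assume "t \<in> {0..s}"
    then have "t \<in> {0..1}" using s by auto
    then have "(\<gamma> has_vector_derivative \<gamma>' t) (at t within {0..1})"
      using c unfolding curve_def by blast
    then show "(\<gamma> has_vector_derivative \<gamma>' t) (at t within {0..s})"
      by (rule has_vector_derivative_within_subset) (use s in auto)
  qed (use s in auto)
  then have "norm (\<gamma> s - \<gamma> 0) \<le> integral {0..s} (\<lambda>s. 1 + (norm (\<gamma>' s))\<^sup>2)"
  proof (subst integral_unique[symmetric], assumption, intro integral_norm_bound_integral sub)
    show "norm (\<gamma>' t) \<le> 1 + (norm (\<gamma>' t))\<^sup>2" for t
      using zero_le_power2[of "norm (\<gamma>' t) - 1"] by (simp add: power2_diff) (smt (verit) norm_ge_zero)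
  qed auto
  also have "\<dots> \<le> integral {0..1} (\<lambda>s. 1 + (norm (\<gamma>' s))\<^sup>2)"
    using s by (intro integral_subset_le sub int) auto
  also have "\<dots> = 1 + integral {0..1} (\<lambda>s. (norm (\<gamma>' s))\<^sup>2)"
    by (subst integral_add) (use int in auto)
  finally have "norm (\<gamma> s - \<gamma> 0) \<le> 1 + energy \<gamma> \<gamma>' / \<beta>" using speed_integral_le[OF c] by simp
  then show ?thesis using norm_triangle_ineq[of p "\<gamma> s - p"] c unfolding curve_def by simp
qed

lemma bounds_on_ball:
  obtains K where "K \<ge> 1"
    "\<And>x. norm x \<le> R \<Longrightarrow> norm (G x) \<le> K \<and> norm (G' x) \<le> K \<and> norm (F x) \<le> K \<and> norm (F' x) \<le> K"
proof -
  have "compact ((\<lambda>x. norm (G x) + norm (G' x) + norm (F x) + norm (F' x)) ` cball 0 R)"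
    by (intro compact_continuous_image continuous_on_add continuous_on_norm compact_cball
        C1_continuous[OF metric_C1] C1_continuous[OF field_C1]
        C1_continuous_derivative[OF metric_C1] C1_continuous_derivative[OF field_C1])
  then have "bounded ((\<lambda>x. norm (G x) + norm (G' x) + norm (F x) + norm (F' x)) ` cball 0 R)"
    by (rule compact_imp_bounded)
  then obtain K where K: "\<forall>x\<in>cball 0 R. \<bar>norm (G x) + norm (G' x) + norm (F x) + norm (F' x)\<bar> \<le> K"
    unfolding bounded_iff by auto
  show ?thesis
  proof (rule that[of "max 1 K"])
    fix x :: 'a assume "norm x \<le> R"
    with K have "norm (G x) + norm (G' x) + norm (F x) + norm (F' x) \<le> K" by auto
    then show "norm (G x) \<le> max 1 K \<and> norm (G' x) \<le> max 1 K \<and> norm (F x) \<le> max 1 K \<and> norm (F' x) \<le> max 1 K"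
      using norm_ge_zero[of "G x"] norm_ge_zero[of "G' x"] norm_ge_zero[of "F x"] norm_ge_zero[of "F' x"]
      by (auto simp del: norm_ge_zero)
  qed simp
qed

text \<open>Pointwise first variation of the energy density. Here \<open>x\<close> and
  \<open>v\<close> are position and velocity on the curve, \<open>u\<close> is the weight
  \<open>1 - \<theta> s\<close> of the push along \<open>F\<close>, \<open>- \<theta>\<close> is the
  derivative of that weight, and \<open>a\<close> corrects the endpoint, entering the position as
  \<open>s a\<close> and the velocity as \<open>a\<close>. The displaced velocity is affine in
  \<open>v\<close>, so the error grows at most like \<open>1 + |v|^2\<close>, which the energy
  controls.\<close>

lemma integrand_variation:
  assumes "\<epsilon> > 0"
  obtains \<delta> where "\<delta> > 0"
    "\<And>h x v u \<theta> a s. 0 < h \<Longrightarrow> h < \<delta> \<Longrightarrow> norm x \<le> R \<Longrightarrow> norm a \<le> \<delta> * h \<Longrightarrow>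
      u \<in> {0..1} \<Longrightarrow> \<theta> \<in> {0..1} \<Longrightarrow> s \<in> {0..1} \<Longrightarrow>
      (v + ((h * u) *\<^sub>R F' x v - (h * \<theta>) *\<^sub>R F x + a)) \<bullet>
        G (x + ((h * u) *\<^sub>R F x + s *\<^sub>R a)) (v + ((h * u) *\<^sub>R F' x v - (h * \<theta>) *\<^sub>R F x + a))
      \<le> v \<bullet> G x v + h * (u * rate x v - 2 * \<theta> * (v \<bullet> G x (F x))) + \<epsilon> * h * (1 + (norm v)\<^sup>2)"
proof -
  obtain K where K1: "K \<ge> 1" and K: "\<And>x. norm x \<le> R \<Longrightarrow>
      norm (G x) \<le> K \<and> norm (G' x) \<le> K \<and> norm (F x) \<le> K \<and> norm (F' x) \<le> K"
    using bounds_on_ball[of R] by blast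
  \<comment> \<open>Here \<open>72 = 4 * 18\<close>, and \<open>92 = 4 * 23\<close> in
    \<open>\<delta>\<close>: the Taylor remainder of \<open>G\<close> will contribute
    \<open>18 K^3 \<eta>\<close> and the other error terms \<open>23 K^4 \<delta>\<close>, so that
    each is at most \<open>\<epsilon> / 4\<close>.\<close>
  define \<eta> where "\<eta> = \<epsilon> / (72 * K ^ 3)"
  have \<eta>: "\<eta> > 0" using assms K1 by (simp add: \<eta>_def)
  obtain \<delta>0 where \<delta>0: "\<delta>0 > 0" "\<And>x y z. norm x \<le> R \<Longrightarrow> dist x y \<le> \<delta>0 \<Longrightarrow> dist x z \<le> \<delta>0 \<Longrightarrow>
      norm (G y - G z - G' x (y - z)) \<le> \<eta> * norm (y - z)"
    using C1_uniform_expansion[OF metric_C1 \<eta>, of R] by blast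
  define \<delta> where "\<delta> = min 1 (min (\<delta>0 / (2 * K)) (\<epsilon> / (92 * K ^ 4)))"
  have \<delta>: "\<delta> > 0" "\<delta> \<le> 1" "2 * K * \<delta> \<le> \<delta>0" "23 * K ^ 4 * \<delta> \<le> \<epsilon> / 4"
  proof -
    show "\<delta> > 0" "\<delta> \<le> 1" using assms K1 \<delta>0(1) by (auto simp: \<delta>_def)
    have "2 * K * \<delta> \<le> 2 * K * (\<delta>0 / (2 * K))" using K1 by (intro mult_left_mono) (auto simp: \<delta>_def)
    then show "2 * K * \<delta> \<le> \<delta>0" using K1 by simp
    have "23 * K ^ 4 * \<delta> \<le> 23 * K ^ 4 * (\<epsilon> / (92 * K ^ 4))"
      using K1 by (intro mult_left_mono) (auto simp: \<delta>_def)
    then show "23 * K ^ 4 * \<delta> \<le> \<epsilon> / 4" using K1 by simp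
  qed
  show ?thesis
  proof (rule that[OF \<delta>(1)])
    fix h u \<theta> s :: real and x v a :: 'a
    assume h: "0 < h" "h < \<delta>" and x: "norm x \<le> R" and a: "norm a \<le> \<delta> * h"
      and u: "u \<in> {0..1}" and \<theta>: "\<theta> \<in> {0..1}" and s: "s \<in> {0..1::real}"
    note Kx = K[OF x]
    define d where "d = (h * u) *\<^sub>R F x + s *\<^sub>R a"
    define w where "w = (h * u) *\<^sub>R F' x v - (h * \<theta>) *\<^sub>R F x + a"
    define r where "r = G (x + d) - G x - G' x d"
    \<comment> \<open>As \<open>n \<ge> 1\<close>, terms that are constant or linear in
      \<open>v\<close> can be absorbed into \<open>n * n\<close>.\<close>
    define n where "n = 1 + norm v"
    have n: "n \<ge> 1" "norm v \<le> n" by (auto simp: n_def)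
    have a': "norm a \<le> h" using a \<delta> h by (meson mult_left_le_one_le mult_right_le_one_le less_imp_le order_trans)
    have hu: "h * u \<le> h" "0 \<le> h * u" "h * \<theta> \<le> h" "0 \<le> h * \<theta>" using h u \<theta> by (auto simp: mult_left_le)
    have d: "norm d \<le> 2 * K * h"
    proof -
      have "norm d \<le> (h * u) * norm (F x) + s * norm a"
        unfolding d_def using hu s by (intro order_trans[OF norm_triangle_ineq]) auto
      also have "\<dots> \<le> h * K + 1 * h"
        using hu Kx s a' h by (intro add_mono mult_mono) auto
      also have "\<dots> \<le> h * K + K * h" using K1 h by (intro add_mono mult_right_mono) auto
      finally show ?thesis by simp
    qed
    have w: "norm w \<le> 2 * K * h * n"
    proof -
      have "norm w \<le> (h * u) * norm (F' x v) + (h * \<theta>) * norm (F x) + norm a"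
        unfolding w_def using hu
        by (intro order_trans[OF norm_triangle_ineq] add_mono order_trans[OF norm_triangle_ineq4]) auto
      also have "norm (F' x v) \<le> K * norm v"
        using Kx by (intro order_trans[OF norm_blinfun] mult_right_mono) auto
      then have "(h * u) * norm (F' x v) + (h * \<theta>) * norm (F x) + norm a \<le> h * (K * norm v) + h * K + K * h"
      proof (intro add_mono mult_mono)
        show "norm a \<le> K * h" using a' K1 h mult_right_mono[of 1 K h] by linarith
      qed (use hu h Kx K1 in auto)
      also have "\<dots> \<le> 2 * K * h * n" using K1 h by (simp add: n_def algebra_simps)
      finally show ?thesis .
    qed
    have Kh: "K * h \<le> K" using h \<delta> K1 by (simp add: mult_left_le)
    have vw: "norm (v + w) \<le> 3 * K * n"
    proof -
      have "norm (v + w) \<le> n + 2 * K * h * n" using n w by (intro order_trans[OF norm_triangle_ineq]) auto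
      also have "\<dots> \<le> K * n + 2 * K * n"
      proof (intro add_mono)
        show "n \<le> K * n" using K1 n mult_right_mono[of 1 K n] by simp
        show "2 * K * h * n \<le> 2 * K * n" using Kh n by (intro mult_right_mono) auto
      qed
      finally show ?thesis by simp
    qed
    have r: "norm r \<le> 2 * K * \<eta> * h"
    proof -
      have "2 * K * h \<le> 2 * K * \<delta>" using h K1 by (intro mult_left_mono) auto
      then have "norm d \<le> \<delta>0" using d \<delta>(3) by linarith
      then have "norm r \<le> \<eta> * norm d"
        using \<delta>0(2)[OF x, of "x + d" x] \<delta>0(1) by (simp add: r_def dist_norm)
      also have "\<dots> \<le> \<eta> * (2 * K * h)" using d \<eta> by (intro mult_left_mono) auto
      finally show ?thesis by (simp add: mult_ac)
    qed
    have G'd: "norm (G' x d) \<le> 2 * K^2 * h"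
    proof -
      have "norm (G' x d) \<le> K * (2 * K * h)"
        using Kx d K1 by (intro order_trans[OF norm_blinfun] mult_mono) auto
      then show ?thesis by (simp add: power2_eq_square)
    qed
    have G'a: "norm (G' x a) \<le> K * (\<delta> * h)"
      using Kx a K1 by (intro order_trans[OF norm_blinfun] mult_mono) auto
    \<comment> \<open>An exact expansion. Symmetry of the metric merges the two mixed products into
      \<open>2 * (v \<bullet> G x w)\<close>, which with the derivative of \<open>G\<close> gives
      the first variation; the last bracket holds the terms to be estimated.\<close>
    have eq: "(v + w) \<bullet> G (x + d) (v + w) = v \<bullet> G x v + h * (u * rate x v - 2 * \<theta> * (v \<bullet> G x (F x)))
       + (2 * (v \<bullet> G x a) + w \<bullet> G x w + s * (v \<bullet> G' x a v) + (w \<bullet> G' x d (v + w) + v \<bullet> G' x d w)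
         + (v + w) \<bullet> r (v + w))"
    proof -
      have 1: "G (x + d) = G x + G' x d + r" by (simp add: r_def)
      have 2: "v \<bullet> G' x d v = h * u * (v \<bullet> G' x (F x) v) + s * (v \<bullet> G' x a v)"
        unfolding d_def by (simp add: blinfun.bilinear_simps inner_add_right)
      have 3: "v \<bullet> G x w = h * u * (v \<bullet> G x (F' x v)) - h * \<theta> * (v \<bullet> G x (F x)) + v \<bullet> G x a"
        unfolding w_def by (simp add: blinfun.bilinear_simps inner_add_right inner_diff_right)
      have "(v + w) \<bullet> G (x + d) (v + w) = v \<bullet> G x v + 2 * (v \<bullet> G x w) + w \<bullet> G x w
        + v \<bullet> G' x d v + (w \<bullet> G' x d (v + w) + v \<bullet> G' x d w) + (v + w) \<bullet> r (v + w)"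
        unfolding 1 using symmetric[of w x v]
        by (simp add: blinfun.bilinear_simps inner_add_right inner_add_left)
      then show ?thesis unfolding 2 3 rate_def by (simp add: algebra_simps)
    qed
    have n2: "0 \<le> n * n * h" using n h by simp
    have p: "K \<le> K ^ 4" "K ^ 3 \<le> K ^ 4"
      using K1 power_increasing[of 1 4 K] power_increasing[of 3 4 K] by auto
    have "v \<bullet> G x a \<le> n * (K * (\<delta> * h))" using n Kx a by (intro inner_blinfun_le) auto
    also have "\<dots> \<le> (n * n) * (K * (\<delta> * h))" using n K1 \<delta> h by (intro mult_right_mono) auto
    also have "\<dots> = K * \<delta> * (n * n * h)" by simp
    also have "\<dots> \<le> K ^ 4 * \<delta> * (n * n * h)" using p \<delta> n2 by (intro mult_right_mono) auto
    finally have t1: "v \<bullet> G x a \<le> K ^ 4 * \<delta> * (n * n * h)" .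
    have "w \<bullet> G x w \<le> (2 * K * h * n) * (K * (2 * K * h * n))" using Kx w by (intro inner_blinfun_le) auto
    also have "\<dots> = 4 * K ^ 3 * h * (n * n * h)" by (simp add: power3_eq_cube)
    also have "\<dots> \<le> 4 * K ^ 4 * \<delta> * (n * n * h)"
      using p h n2 K1 by (intro mult_right_mono mult_mono) auto
    finally have t2: "w \<bullet> G x w \<le> 4 * K ^ 4 * \<delta> * (n * n * h)" .
    have "s * (v \<bullet> G' x a v) \<le> s * (n * (K * (\<delta> * h) * n))"
      using s n G'a by (intro mult_left_mono inner_blinfun_le) auto
    also have "\<dots> \<le> 1 * (n * (K * (\<delta> * h) * n))" using s n K1 \<delta> h by (intro mult_right_mono) auto
    also have "\<dots> = K * \<delta> * (n * n * h)" by simp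
    also have "\<dots> \<le> K ^ 4 * \<delta> * (n * n * h)" using p \<delta> n2 by (intro mult_right_mono) auto
    finally have t3: "s * (v \<bullet> G' x a v) \<le> K ^ 4 * \<delta> * (n * n * h)" .
    have "w \<bullet> G' x d (v + w) \<le> (2 * K * h * n) * (2 * K^2 * h * (3 * K * n))"
      using w vw G'd by (intro inner_blinfun_le)
    also have "\<dots> = 12 * K ^ 4 * h * (n * n * h)" by (simp add: power2_eq_square power4_eq_xxxx)
    also have "\<dots> \<le> 12 * K ^ 4 * \<delta> * (n * n * h)"
      using h n2 K1 by (intro mult_right_mono mult_left_mono) auto
    finally have t4: "w \<bullet> G' x d (v + w) \<le> 12 * K ^ 4 * \<delta> * (n * n * h)" .
    have "v \<bullet> G' x d w \<le> n * (2 * K^2 * h * (2 * K * h * n))"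
      using n w G'd by (intro inner_blinfun_le)
    also have "\<dots> = 4 * K ^ 3 * h * (n * n * h)" by (simp add: power2_eq_square power3_eq_cube)
    also have "\<dots> \<le> 4 * K ^ 4 * \<delta> * (n * n * h)"
      using p h n2 K1 by (intro mult_right_mono mult_mono) auto
    finally have t5: "v \<bullet> G' x d w \<le> 4 * K ^ 4 * \<delta> * (n * n * h)" .
    have "(v + w) \<bullet> r (v + w) \<le> (3 * K * n) * (2 * K * \<eta> * h * (3 * K * n))"
      using vw r by (intro inner_blinfun_le)
    also have "\<dots> = 18 * K ^ 3 * \<eta> * (n * n * h)" by (simp add: power3_eq_cube)
    also have "18 * K ^ 3 * \<eta> = \<epsilon> / 4" using K1 by (simp add: \<eta>_def)
    finally have t6: "(v + w) \<bullet> r (v + w) \<le> \<epsilon> / 4 * (n * n * h)" .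
    \<comment> \<open>The coefficients add up to \<open>2 + 4 + 1 + 12 + 4 = 23\<close>; the
      remainder term is kept separate.\<close>
    have "2 * (v \<bullet> G x a) + w \<bullet> G x w + s * (v \<bullet> G' x a v) + (w \<bullet> G' x d (v + w) + v \<bullet> G' x d w)
         + (v + w) \<bullet> r (v + w) \<le> (23 * K ^ 4 * \<delta>) * (n * n * h) + \<epsilon> / 4 * (n * n * h)"
      using t1 t2 t3 t4 t5 t6 by linarith
    also have "\<dots> \<le> \<epsilon> / 4 * (n * n * h) + \<epsilon> / 4 * (n * n * h)"
      using \<delta>(4) n2 by (intro add_mono mult_right_mono) auto
    also have "\<dots> = \<epsilon> / 2 * h * (n * n)" by simp
    also have "\<dots> \<le> \<epsilon> / 2 * h * (2 * (1 + (norm v)\<^sup>2))"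
    proof (intro mult_left_mono)
      show "n * n \<le> 2 * (1 + (norm v)\<^sup>2)"
        using zero_le_power2[of "norm v - 1"] by (simp add: n_def power2_eq_square algebra_simps)
    qed (use assms h in auto)
    also have "\<dots> = \<epsilon> * h * (1 + (norm v)\<^sup>2)" by simp
    finally show "(v + ((h * u) *\<^sub>R F' x v - (h * \<theta>) *\<^sub>R F x + a)) \<bullet>
        G (x + ((h * u) *\<^sub>R F x + s *\<^sub>R a)) (v + ((h * u) *\<^sub>R F' x v - (h * \<theta>) *\<^sub>R F x + a))
      \<le> v \<bullet> G x v + h * (u * rate x v - 2 * \<theta> * (v \<bullet> G x (F x))) + \<epsilon> * h * (1 + (norm v)\<^sup>2)"
      unfolding d_def[symmetric] w_def[symmetric] eq by (rule add_left_mono)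
  qed
qed

text \<open>The competitor is \<open>\<gamma> + h (1 - \<theta> s) F(\<gamma>) + s a\<close>. It
  starts at \<open>p\<close> because \<open>F p = 0\<close>. For \<open>\<theta> = 0\<close> its end
  makes an Euler step with error \<open>a\<close>; for \<open>\<theta> = 1\<close> and
  \<open>a = 0\<close> both ends stay fixed. The energy bound \<open>B\<close> makes
  \<open>\<delta>\<close> independent of the curve and of \<open>q\<close>.\<close>

lemma min_energy_variation:
  assumes "\<epsilon> > 0" "F p = 0"
  obtains \<delta> where "\<delta> > 0"
    "\<And>h q a \<gamma> \<gamma>' \<theta>. 0 < h \<Longrightarrow> h < \<delta> \<Longrightarrow> norm a \<le> \<delta> * h \<Longrightarrow> curve p q \<gamma> \<gamma>' \<Longrightarrow>
      energy \<gamma> \<gamma>' \<le> B \<Longrightarrow> \<theta> \<in> {0..1} \<Longrightarrow>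
      min_energy p (q + (h * (1 - \<theta>)) *\<^sub>R F q + a) \<le> energy \<gamma> \<gamma>'
        + h * integral {0..1} (\<lambda>s. (1 - \<theta> * s) * rate (\<gamma> s) (\<gamma>' s) - 2 * \<theta> * (\<gamma>' s \<bullet> G (\<gamma> s) (F (\<gamma> s))))
        + \<epsilon> * h"
proof -
  define R where "R = norm p + 1 + B / \<beta>"
  \<comment> \<open>The integral of the factor \<open>1 + |v|^2\<close> along the curve is at most
    \<open>1 + |B| / \<beta>\<close>.\<close>
  define \<epsilon>' where "\<epsilon>' = \<epsilon> / (1 + \<bar>B\<bar> / \<beta>)"
  have pos: "1 + \<bar>B\<bar> / \<beta> > 0" using beta_pos by (simp add: add_pos_nonneg)
  have \<epsilon>': "\<epsilon>' > 0" using assms pos by (simp add: \<epsilon>'_def)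
  obtain \<delta> where \<delta>: "\<delta> > 0" "\<And>h x v u \<theta> a s. 0 < h \<Longrightarrow> h < \<delta> \<Longrightarrow> norm x \<le> R \<Longrightarrow> norm a \<le> \<delta> * h \<Longrightarrow>
      u \<in> {0..1} \<Longrightarrow> \<theta> \<in> {0..1} \<Longrightarrow> s \<in> {0..1} \<Longrightarrow>
      (v + ((h * u) *\<^sub>R F' x v - (h * \<theta>) *\<^sub>R F x + a)) \<bullet>
        G (x + ((h * u) *\<^sub>R F x + s *\<^sub>R a)) (v + ((h * u) *\<^sub>R F' x v - (h * \<theta>) *\<^sub>R F x + a))
      \<le> v \<bullet> G x v + h * (u * rate x v - 2 * \<theta> * (v \<bullet> G x (F x))) + \<epsilon>' * h * (1 + (norm v)\<^sup>2)"
    using integrand_variation[OF \<epsilon>', of R] by blast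
  show ?thesis
  proof (rule that[OF \<delta>(1)])
    fix h \<theta> :: real and q a :: 'a and \<gamma> \<gamma>'
    assume h: "0 < h" "h < \<delta>" and a: "norm a \<le> \<delta> * h" and c: "curve p q \<gamma> \<gamma>'"
      and B: "energy \<gamma> \<gamma>' \<le> B" and \<theta>: "\<theta> \<in> {0..1}"
    let ?I = "\<lambda>s. (1 - \<theta> * s) * rate (\<gamma> s) (\<gamma>' s) - 2 * \<theta> * (\<gamma>' s \<bullet> G (\<gamma> s) (F (\<gamma> s)))"
    define \<Gamma> where "\<Gamma> s = \<gamma> s + ((h * (1 - \<theta> * s)) *\<^sub>R F (\<gamma> s) + s *\<^sub>R a)" for s
    define \<Gamma>' where "\<Gamma>' s = \<gamma>' s + ((h * (1 - \<theta> * s)) *\<^sub>R F' (\<gamma> s) (\<gamma>' s) - (h * \<theta>) *\<^sub>R F (\<gamma> s) + a)" for s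
    have "curve p (q + (h * (1 - \<theta>)) *\<^sub>R F q + a) \<Gamma> \<Gamma>'"
      unfolding curve_def
    proof (intro conjI ballI)
      show "\<Gamma> 0 = p" "\<Gamma> 1 = q + (h * (1 - \<theta>)) *\<^sub>R F q + a"
        using c assms(2) by (auto simp: \<Gamma>_def curve_def)
      show "continuous_on {0..1} \<Gamma>'" unfolding \<Gamma>'_def
        by (intro curve_intros curve_continuous[OF c] curve_continuous_derivative[OF c])
      fix s :: real assume s: "s \<in> {0..1}"
      have \<gamma>: "(\<gamma> has_vector_derivative \<gamma>' s) (at s within {0..1})" using c s by (simp add: curve_def)
      have "((F \<circ> \<gamma>) has_vector_derivative F' (\<gamma> s) (\<gamma>' s)) (at s within {0..1})"
        using vector_derivative_diff_chain_within[OF \<gamma> C1_has_derivative[OF field_C1]] .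
      then have F: "((\<lambda>s. F (\<gamma> s)) has_vector_derivative F' (\<gamma> s) (\<gamma>' s)) (at s within {0..1})"
        by (simp add: o_def)
      show "(\<Gamma> has_vector_derivative \<Gamma>' s) (at s within {0..1})"
        unfolding \<Gamma>_def \<Gamma>'_def
        by (auto intro!: derivative_eq_intros \<gamma> F simp: algebra_simps)
    qed
    then have "min_energy p (q + (h * (1 - \<theta>)) *\<^sub>R F q + a) \<le> energy \<Gamma> \<Gamma>'"
      and int\<Gamma>: "((\<lambda>s. \<Gamma>' s \<bullet> G (\<Gamma> s) (\<Gamma>' s)) has_integral energy \<Gamma> \<Gamma>') {0..1}"
      by (auto intro: min_energy_le energy_has_integral)
    moreover have "energy \<Gamma> \<Gamma>' \<le> energy \<gamma> \<gamma>' + h * integral {0..1} ?I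
        + \<epsilon>' * h * (1 + integral {0..1} (\<lambda>s. (norm (\<gamma>' s))\<^sup>2))"
    proof (rule has_integral_le[OF int\<Gamma>])
      have iI: "(?I has_integral integral {0..1} ?I) {0..1}"
        unfolding rate_def by (intro integrable_integral integrable_continuous_interval curve_intros
            curve_continuous[OF c] curve_continuous_derivative[OF c])
      have iN: "((\<lambda>s. (norm (\<gamma>' s))\<^sup>2) has_integral integral {0..1} (\<lambda>s. (norm (\<gamma>' s))\<^sup>2)) {0..1}"
        by (intro integrable_integral integrable_continuous_interval curve_intros
            curve_continuous[OF c] curve_continuous_derivative[OF c])
      have i1: "((\<lambda>s. 1) has_integral (1::real)) {0..1::real}"
        using has_integral_const_real[of "1::real" 0 1] by simp
      show "((\<lambda>s. \<gamma>' s \<bullet> G (\<gamma> s) (\<gamma>' s) + h * ?I s + \<epsilon>' * h * (1 + (norm (\<gamma>' s))\<^sup>2)) has_integral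
        energy \<gamma> \<gamma>' + h * integral {0..1} ?I + \<epsilon>' * h * (1 + integral {0..1} (\<lambda>s. (norm (\<gamma>' s))\<^sup>2))) {0..1}"
        by (intro has_integral_add has_integral_mult_right energy_has_integral[OF c] iI iN i1)
      fix s :: real assume s: "s \<in> {0..1}"
      have "norm (\<gamma> s) \<le> norm p + 1 + energy \<gamma> \<gamma>' / \<beta>" by (rule curve_norm_le[OF c s])
      also have "\<dots> \<le> R" unfolding R_def using B beta_pos by (simp add: divide_right_mono)
      finally have "norm (\<gamma> s) \<le> R" .
      moreover have "1 - \<theta> * s \<in> {0..1}" using \<theta> s by (auto simp: mult_le_one)
      ultimately show "\<Gamma>' s \<bullet> G (\<Gamma> s) (\<Gamma>' s)
          \<le> \<gamma>' s \<bullet> G (\<gamma> s) (\<gamma>' s) + h * ?I s + \<epsilon>' * h * (1 + (norm (\<gamma>' s))\<^sup>2)"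
        unfolding \<Gamma>_def \<Gamma>'_def by (intro \<delta>(2) h a \<theta> s)
    qed
    moreover have "\<epsilon>' * h * (1 + integral {0..1} (\<lambda>s. (norm (\<gamma>' s))\<^sup>2)) \<le> \<epsilon> * h"
    proof -
      have "energy \<gamma> \<gamma>' / \<beta> \<le> \<bar>B\<bar> / \<beta>" using B beta_pos by (intro divide_right_mono) auto
      then have "\<epsilon>' * h * (1 + integral {0..1} (\<lambda>s. (norm (\<gamma>' s))\<^sup>2)) \<le> \<epsilon>' * h * (1 + \<bar>B\<bar> / \<beta>)"
        using speed_integral_le[OF c] \<epsilon>' h by (intro mult_left_mono) auto
      also have "\<dots> = \<epsilon> * h" using pos by (simp add: \<epsilon>'_def)
      finally show ?thesis .
    qed
    ultimately show "min_energy p (q + (h * (1 - \<theta>)) *\<^sub>R F q + a)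
        \<le> energy \<gamma> \<gamma>' + h * integral {0..1} ?I + \<epsilon> * h" by linarith
  qed
qed

end

section \<open>Critical points as minima, and the speed along a solution\<close>

context riemannian_field
begin

text \<open>Push a nearly minimizing curve from \<open>p\<close> to \<open>q\<close> along \<open>(1 - s) F\<close>: this fixes both endpoints,
  so it cannot lower the energy by much, although its first variation is
  at most \<open>2 (f q - f p)\<close>.\<close>

lemma critical_point_minimal:
  assumes p: "F p = 0" and rate: "\<And>x v. rate x v \<le> 0"
    and f: "\<And>x. (f has_derivative (\<lambda>v. - (v \<bullet> G x (F x)))) (at x)"
  shows "f p \<le> f q"
proof (rule field_le_epsilon)
  fix \<epsilon> :: real assume \<epsilon>: "\<epsilon> > 0"
  define B where "B = min_energy p q + 1"
  obtain \<delta> where \<delta>: "\<delta> > 0"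
    "\<And>h q a \<gamma> \<gamma>' \<theta>. 0 < h \<Longrightarrow> h < \<delta> \<Longrightarrow> norm a \<le> \<delta> * h \<Longrightarrow> curve p q \<gamma> \<gamma>' \<Longrightarrow>
      energy \<gamma> \<gamma>' \<le> B \<Longrightarrow> \<theta> \<in> {0..1} \<Longrightarrow>
      min_energy p (q + (h * (1 - \<theta>)) *\<^sub>R F q + a) \<le> energy \<gamma> \<gamma>'
        + h * integral {0..1} (\<lambda>s. (1 - \<theta> * s) * rate (\<gamma> s) (\<gamma>' s) - 2 * \<theta> * (\<gamma>' s \<bullet> G (\<gamma> s) (F (\<gamma> s))))
        + \<epsilon> * h"
    using min_energy_variation[OF \<epsilon> p, of B] by blast
  define h where "h = \<delta> / 2"
  have h: "0 < h" "h < \<delta>" using \<delta>(1) by (auto simp: h_def)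
  \<comment> \<open>The slack of the nearly minimizing curve is proportional to the step, so that
    division by \<open>h\<close> leaves only \<open>\<epsilon>\<close>; the \<open>1\<close> keeps
    the energy below \<open>B\<close>.\<close>
  have "min 1 (\<epsilon> * h) > 0" using \<epsilon> h by simp
  then obtain \<gamma> \<gamma>' where c: "curve p q \<gamma> \<gamma>'" and e: "energy \<gamma> \<gamma>' < min_energy p q + min 1 (\<epsilon> * h)"
    by (rule min_energy_approx)
  let ?I = "\<lambda>s. (1 - 1 * s) * rate (\<gamma> s) (\<gamma>' s) - 2 * 1 * (\<gamma>' s \<bullet> G (\<gamma> s) (F (\<gamma> s)))"
  have "min_energy p (q + (h * (1 - 1)) *\<^sub>R F q + 0) \<le> energy \<gamma> \<gamma>' + h * integral {0..1} ?I + \<epsilon> * h"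
    using e h by (intro \<delta>(2) c) (auto simp: B_def)
  then have "0 \<le> h * (integral {0..1} ?I + 2 * \<epsilon>)" using e by (simp add: algebra_simps)
  then have "- (2 * \<epsilon>) \<le> integral {0..1} ?I" using h by (simp add: zero_le_mult_iff)
  also have "\<dots> \<le> 2 * (f q - f p)"
  proof (rule has_integral_le)
    show "(?I has_integral integral {0..1} ?I) {0..1}"
      unfolding rate_def by (intro integrable_integral integrable_continuous_interval curve_intros
          curve_continuous[OF c] curve_continuous_derivative[OF c])
    have "((\<lambda>s. - (\<gamma>' s \<bullet> G (\<gamma> s) (F (\<gamma> s)))) has_integral ((f \<circ> \<gamma>) 1 - (f \<circ> \<gamma>) 0)) {0..1}"
    proof (rule fundamental_theorem_of_calculus)
      fix s :: real assume "s \<in> {0..1}"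
      then have "(\<gamma> has_vector_derivative \<gamma>' s) (at s within {0..1})" using c by (simp add: curve_def)
      from vector_derivative_diff_chain_within[OF this has_derivative_at_withinI[OF f]]
      show "((f \<circ> \<gamma>) has_vector_derivative - (\<gamma>' s \<bullet> G (\<gamma> s) (F (\<gamma> s)))) (at s within {0..1})" .
    qed simp
    from has_integral_mult_right[OF this, of 2] c
    show "((\<lambda>s. 2 * - (\<gamma>' s \<bullet> G (\<gamma> s) (F (\<gamma> s)))) has_integral 2 * (f q - f p)) {0..1}"
      by (simp add: curve_def)
    fix s :: real assume "s \<in> {0..1}"
    then have "(1 - s) * rate (\<gamma> s) (\<gamma>' s) \<le> 0" using rate by (intro mult_nonneg_nonpos) auto
    then show "?I s \<le> 2 * - (\<gamma>' s \<bullet> G (\<gamma> s) (F (\<gamma> s)))" by simp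
  qed
  finally show "f p \<le> f q + \<epsilon>" by simp
qed

text \<open>The \<open>V\<close> of the overview. By coercivity its zeros are the
  equilibria.\<close>

definition speed :: "'a \<Rightarrow> real" where
  "speed x = F x \<bullet> G x (F x)"

lemma speed_nonneg: "0 \<le> speed x"
  by (simp add: speed_def metric_nonneg)

text \<open>Along a solution the vector \<open>F (x t)\<close> obeys the linearized flow, its
  derivative being \<open>F' (x t) (F (x t))\<close>; hence its squared length changes by the Lie
  derivative evaluated on \<open>F\<close> itself.\<close>

lemma speed_derivative:
  assumes x: "(x has_vector_derivative F (x t)) (at t within S)"
  shows "((\<lambda>t. speed (x t)) has_real_derivative rate (x t) (F (x t))) (at t within S)"
proof -
  have F: "((F \<circ> x) has_vector_derivative F' (x t) (F (x t))) (at t within S)"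
    and G: "((G \<circ> x) has_vector_derivative G' (x t) (F (x t))) (at t within S)"
    using vector_derivative_diff_chain_within[OF x C1_has_derivative[OF field_C1]]
      vector_derivative_diff_chain_within[OF x C1_has_derivative[OF metric_C1]] .
  have GF: "((\<lambda>t. G (x t) (F (x t))) has_vector_derivative
      G' (x t) (F (x t)) (F (x t)) + G (x t) (F' (x t) (F (x t)))) (at t within S)"
    using bounded_bilinear.has_vector_derivative[OF blinfun.bounded_bilinear_axioms G F]
    by (simp add: o_def add.commute)
  have "((\<lambda>t. F (x t) \<bullet> G (x t) (F (x t))) has_vector_derivative rate (x t) (F (x t))) (at t within S)"
    using bounded_bilinear.has_vector_derivative[OF bounded_bilinear_inner F GF]
      symmetric[of "F' (x t) (F (x t))" "x t" "F (x t)"]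
    by (simp add: o_def rate_def inner_add_right inner_commute algebra_simps)
  then show ?thesis
    unfolding speed_def has_real_derivative_iff_has_vector_derivative .
qed

end

lemma uniform_euler_step:
  fixes x :: "real \<Rightarrow> 'a::real_normed_vector"
  assumes x: "\<And>t. t \<in> {a..b} \<Longrightarrow> (x has_vector_derivative x' t) (at t within {a..b})"
    and x': "continuous_on {a..b} x'" and "\<delta> > 0"
  obtains \<eta> where "\<eta> > 0"
    "\<And>t h. a \<le> t \<Longrightarrow> 0 < h \<Longrightarrow> h < \<eta> \<Longrightarrow> t + h \<le> b \<Longrightarrow> norm (x (t + h) - x t - h *\<^sub>R x' t) \<le> \<delta> * h"
proof -
  have "uniformly_continuous_on {a..b} x'" by (intro compact_uniformly_continuous x') simp
  then obtain \<eta> where \<eta>: "\<eta> > 0"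
    "\<And>s t. s \<in> {a..b} \<Longrightarrow> t \<in> {a..b} \<Longrightarrow> dist s t < \<eta> \<Longrightarrow> dist (x' s) (x' t) < \<delta>"
    using \<open>\<delta> > 0\<close> unfolding uniformly_continuous_on_def by blast
  show ?thesis
  proof (rule that[OF \<eta>(1)])
    fix t h assume th: "a \<le> t" "0 < h" "h < \<eta>" "t + h \<le> b"
    have "norm (x (t + h) - x t - (t + h - t) *\<^sub>R x' t) \<le> norm (t + h - t) * \<delta>"
    proof (rule vector_differentiable_bound_linearization[where S = "{t..t + h}"])
      fix s assume "s \<in> {t..t + h}"
      then show "(x has_vector_derivative x' s) (at s within {t..t + h})"
        using th by (intro has_vector_derivative_within_subset[OF x]) auto
      have "dist (x' s) (x' t) < \<delta>" using \<open>s \<in> {t..t + h}\<close> th by (intro \<eta>(2)) (auto simp: dist_real_def)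
      then show "norm (x' s - x' t) \<le> \<delta>" by (simp add: dist_norm)
    qed (use th in \<open>auto simp: closed_segment_eq_real_ivl\<close>)
    then show "norm (x (t + h) - x t - h *\<^sub>R x' t) \<le> \<delta> * h" using th by (simp add: mult.commute)
  qed
qed

text \<open>\<open>\<pi>\<close> singles out the directions in which the contraction is strict; in
  the game it is the projection to player 1.\<close>

locale semicontracting_field = riemannian_field G G' F F' \<beta>
  for G :: "'a::euclidean_space \<Rightarrow> 'a \<Rightarrow>\<^sub>L 'a" and G' F F' \<beta> +
  fixes \<pi> :: "'a \<Rightarrow>\<^sub>L 'c::euclidean_space" and c :: real
  assumes c_pos: "c > 0" and contraction: "rate x v \<le> - c * (norm (\<pi> v))\<^sup>2"
begin

text \<open>The case \<open>\<theta> = 0\<close> for nearly minimizing curves. Since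
  \<open>\<pi> (q - p)\<close> is the integral of \<open>\<pi> (\<gamma>' s)\<close>, the mean
  inequality bounds the integrated rate by \<open>- c |\<pi> (q - p)|^2\<close>. One
  \<open>\<delta>\<close> serves all \<open>q\<close> with \<open>min_energy p q < B\<close>, so
  steps can be iterated.\<close>

lemma min_energy_step:
  assumes "\<epsilon> > 0" "F p = 0"
  obtains \<delta> where "\<delta> > 0"
    "\<And>h q a. 0 < h \<Longrightarrow> h < \<delta> \<Longrightarrow> norm a \<le> \<delta> * h \<Longrightarrow> min_energy p q < B \<Longrightarrow>
      min_energy p (q + h *\<^sub>R F q + a) \<le> min_energy p q - c * (norm (\<pi> (q - p)))\<^sup>2 * h + \<epsilon> * h"
proof -
  obtain \<delta> where \<delta>: "\<delta> > 0"
    "\<And>h q a \<gamma> \<gamma>' \<theta>. 0 < h \<Longrightarrow> h < \<delta> \<Longrightarrow> norm a \<le> \<delta> * h \<Longrightarrow> curve p q \<gamma> \<gamma>' \<Longrightarrow>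
      energy \<gamma> \<gamma>' \<le> B \<Longrightarrow> \<theta> \<in> {0..1} \<Longrightarrow>
      min_energy p (q + (h * (1 - \<theta>)) *\<^sub>R F q + a) \<le> energy \<gamma> \<gamma>'
        + h * integral {0..1} (\<lambda>s. (1 - \<theta> * s) * rate (\<gamma> s) (\<gamma>' s) - 2 * \<theta> * (\<gamma>' s \<bullet> G (\<gamma> s) (F (\<gamma> s))))
        + \<epsilon> * h"
    using min_energy_variation[OF assms, of B] by blast
  show ?thesis
  proof (rule that[OF \<delta>(1)])
    fix h :: real and q a :: 'a
    assume h: "0 < h" "h < \<delta>" and a: "norm a \<le> \<delta> * h" and B: "min_energy p q < B"
    show "min_energy p (q + h *\<^sub>R F q + a) \<le> min_energy p q - c * (norm (\<pi> (q - p)))\<^sup>2 * h + \<epsilon> * h"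
    proof (rule field_le_epsilon)
      fix \<eta> :: real assume "\<eta> > 0"
      then have "min \<eta> (B - min_energy p q) > 0" using B by simp
      then obtain \<gamma> \<gamma>' where g: "curve p q \<gamma> \<gamma>'"
        and e: "energy \<gamma> \<gamma>' < min_energy p q + min \<eta> (B - min_energy p q)"
        by (rule min_energy_approx)
      have "min_energy p (q + (h * (1 - 0)) *\<^sub>R F q + a) \<le> energy \<gamma> \<gamma>'
        + h * integral {0..1} (\<lambda>s. (1 - 0 * s) * rate (\<gamma> s) (\<gamma>' s) - 2 * 0 * (\<gamma>' s \<bullet> G (\<gamma> s) (F (\<gamma> s))))
        + \<epsilon> * h"
        using e by (intro \<delta>(2) h a g) auto
      moreover have "integral {0..1} (\<lambda>s. rate (\<gamma> s) (\<gamma>' s)) \<le> - c * (norm (\<pi> (q - p)))\<^sup>2"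
      proof -
        have cont: "continuous_on {0..1} (\<lambda>s. \<pi> (\<gamma>' s))"
          by (intro curve_intros curve_continuous_derivative[OF g])
        have "integral {0..1} (\<lambda>s. rate (\<gamma> s) (\<gamma>' s)) \<le> integral {0..1} (\<lambda>s. - c * (norm (\<pi> (\<gamma>' s)))\<^sup>2)"
        proof (intro integral_le contraction)
          show "(\<lambda>s. rate (\<gamma> s) (\<gamma>' s)) integrable_on {0..1}" "(\<lambda>s. - c * (norm (\<pi> (\<gamma>' s)))\<^sup>2) integrable_on {0..1}"
            unfolding rate_def by (intro integrable_continuous_interval curve_intros
                curve_continuous[OF g] curve_continuous_derivative[OF g])+
        qed
        also have "\<dots> = - c * integral {0..1} (\<lambda>s. (norm (\<pi> (\<gamma>' s)))\<^sup>2)" by simp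
        also have "\<dots> \<le> - c * (norm (integral {0..1} (\<lambda>s. \<pi> (\<gamma>' s))))\<^sup>2"
          using norm_integral_squared_le[OF cont] c_pos by simp
        also have "integral {0..1} (\<lambda>s. \<pi> (\<gamma>' s)) = \<pi> (q - p)"
          using has_integral_linear[OF curve_integral[OF g] blinfun.bounded_linear_right[of \<pi>]]
          by (simp add: o_def integral_unique)
        finally show ?thesis .
      qed
      then have "h * integral {0..1} (\<lambda>s. rate (\<gamma> s) (\<gamma>' s)) \<le> h * (- c * (norm (\<pi> (q - p)))\<^sup>2)"
        using h by (intro mult_left_mono) auto
      ultimately show "min_energy p (q + h *\<^sub>R F q + a)
          \<le> min_energy p q - c * (norm (\<pi> (q - p)))\<^sup>2 * h + \<epsilon> * h + \<eta>"
        using e by (simp add: algebra_simps)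
    qed
  qed
qed

text \<open>An Euler step leaves the equilibrium \<open>q\<close> in place, although the energy from
  \<open>p\<close> would have to drop by \<open>c |\<pi> (q - p)|^2 h\<close> up to
  \<open>\<epsilon> h\<close>.\<close>

lemma equilibria_unique:
  assumes "F p = 0" "F q = 0"
  shows "\<pi> p = \<pi> q"
proof -
  have "c * (norm (\<pi> (q - p)))\<^sup>2 \<le> 0 + \<epsilon>" if \<epsilon>: "\<epsilon> > 0" for \<epsilon>
  proof -
    obtain \<delta> where \<delta>: "\<delta> > 0" "\<And>h q' a. 0 < h \<Longrightarrow> h < \<delta> \<Longrightarrow> norm a \<le> \<delta> * h \<Longrightarrow>
      min_energy p q' < min_energy p q + 1 \<Longrightarrow>
      min_energy p (q' + h *\<^sub>R F q' + a) \<le> min_energy p q' - c * (norm (\<pi> (q' - p)))\<^sup>2 * h + \<epsilon> * h"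
      using min_energy_step[OF \<epsilon> assms(1), of "min_energy p q + 1"] by blast
    have "min_energy p q \<le> min_energy p q - c * (norm (\<pi> (q - p)))\<^sup>2 * (\<delta> / 2) + \<epsilon> * (\<delta> / 2)"
      using \<delta>(2)[of "\<delta> / 2" 0 q] \<delta>(1) assms(2) by simp
    then have "(c * (norm (\<pi> (q - p)))\<^sup>2) * (\<delta> / 2) \<le> \<epsilon> * (\<delta> / 2)" by simp
    then show ?thesis using \<delta>(1) by (simp only: mult_le_cancel_right) simp
  qed
  then have "c * (norm (\<pi> (q - p)))\<^sup>2 \<le> 0" by (rule field_le_epsilon)
  then show ?thesis using c_pos by (simp add: mult_le_0_iff blinfun.diff_right)
qed

text \<open>The interval is covered by equal Euler steps whose errors sum to
  \<open>\<epsilon> * (b - a)\<close>. This stands in for differentiating \<open>min_energy\<close>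
  along the solution, which need not be possible.\<close>

lemma min_energy_decreasing:
  assumes p: "F p = 0" and "a \<le> b"
    and x: "\<And>t. t \<in> {a..b} \<Longrightarrow> (x has_vector_derivative F (x t)) (at t within {a..b})"
  shows "min_energy p (x b) \<le> min_energy p (x a)"
proof (cases "a = b")
  case False
  with \<open>a \<le> b\<close> have ab: "a < b" by simp
  have cont: "continuous_on {a..b} (\<lambda>t. F (x t))"
    by (intro continuous_on_compose_C1 continuous_on_vector_derivative[of _ x "\<lambda>t. F (x t)"] x)
  show ?thesis
  proof (rule field_le_epsilon)
    fix e :: real assume e: "e > 0"
    \<comment> \<open>In the total error \<open>min 1 e\<close> the \<open>e\<close> is for the
      conclusion; the \<open>1\<close> keeps all intermediate energies below
      \<open>min_energy p (x a) + 2\<close>, where the step estimate is valid.\<close>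
    define \<epsilon> where "\<epsilon> = min 1 e / (b - a)"
    have \<epsilon>: "\<epsilon> > 0" "\<epsilon> * (b - a) = min 1 e" using e ab by (auto simp: \<epsilon>_def)
    obtain \<delta> where \<delta>: "\<delta> > 0" "\<And>h q r. 0 < h \<Longrightarrow> h < \<delta> \<Longrightarrow> norm r \<le> \<delta> * h \<Longrightarrow>
      min_energy p q < min_energy p (x a) + 2 \<Longrightarrow>
      min_energy p (q + h *\<^sub>R F q + r) \<le> min_energy p q - c * (norm (\<pi> (q - p)))\<^sup>2 * h + \<epsilon> * h"
      using min_energy_step[OF \<epsilon>(1) p, of "min_energy p (x a) + 2"] by metis
    obtain \<eta> where \<eta>: "\<eta> > 0" "\<And>t h. a \<le> t \<Longrightarrow> 0 < h \<Longrightarrow> h < \<eta> \<Longrightarrow> t + h \<le> b \<Longrightarrow>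
        norm (x (t + h) - x t - h *\<^sub>R F (x t)) \<le> \<delta> * h"
      by (rule uniform_euler_step[OF x cont \<delta>(1)]) blast+
    obtain n where n: "n > 0" "(b - a) / real n < min \<delta> \<eta>"
      using real_arch_inverse[of "min \<delta> \<eta> / (b - a)"] \<delta>(1) \<eta>(1) ab
      by (auto simp: field_simps)
    define h where "h = (b - a) / real n"
    have h: "0 < h" "h < \<delta>" "h < \<eta>" using n ab by (auto simp: h_def)
    have nh: "real n * h = b - a" using n by (simp add: h_def)
    have "min_energy p (x (a + real j * h)) \<le> min_energy p (x a) + \<epsilon> * (real j * h)" if "j \<le> n" for j
      using that
    proof (induction j)
      case (Suc j)
      let ?t = "a + real j * h"
      have "real (Suc j) * h \<le> b - a" using Suc.prems h nh by (metis mult_right_mono of_nat_mono less_imp_le)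
      then have t: "a \<le> ?t" "?t + h \<le> b" and jh: "real j * h \<le> b - a" using h by (auto simp: algebra_simps)
      have IH: "min_energy p (x ?t) \<le> min_energy p (x a) + \<epsilon> * (real j * h)" using Suc by simp
      moreover have "\<epsilon> * (real j * h) \<le> 1" using mult_left_mono[OF jh, of \<epsilon>] \<epsilon> by simp
      ultimately have "min_energy p (x ?t + h *\<^sub>R F (x ?t) + (x (?t + h) - x ?t - h *\<^sub>R F (x ?t)))
        \<le> min_energy p (x ?t) - c * (norm (\<pi> (x ?t - p)))\<^sup>2 * h + \<epsilon> * h"
        by (intro \<delta>(2) \<eta>(2) h t) simp
      then have "min_energy p (x (?t + h)) \<le> min_energy p (x ?t) - c * (norm (\<pi> (x ?t - p)))\<^sup>2 * h + \<epsilon> * h"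
        by simp
      moreover have "c * (norm (\<pi> (x ?t - p)))\<^sup>2 * h \<ge> 0" using c_pos h by simp
      moreover have "a + real (Suc j) * h = ?t + h" by (simp add: algebra_simps)
      ultimately show ?case using IH by (simp add: algebra_simps)
    qed simp
    from this[of n] show "min_energy p (x b) \<le> min_energy p (x a) + e"
      using nh \<epsilon> by (simp add: min_def split: if_splits)
  qed
qed simp

text \<open>\<open>\<Phi>\<close> is bounded along the solution and decreases at the rate of the
  speed, up to \<open>\<epsilon>\<close> and a multiple of \<open>|\<pi> F|^2\<close> that the decay
  of the speed itself pays for. As the speed is monotone, one mean value over \<open>{0..T}\<close>
  bounds it at time \<open>T\<close> by \<open>\<epsilon> + O(1 / T)\<close>.\<close>

lemma speed_tendsto_0:
  assumes x: "\<And>t. t \<ge> 0 \<Longrightarrow> (x has_vector_derivative F (x t)) (at t within {0..})"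
    and bounded: "bounded (x ` {0..})"
    and \<Phi>: "\<And>x. (\<Phi> has_derivative \<Phi>' x) (at x)"
    and dissipation: "\<And>R \<epsilon>. \<epsilon> > 0 \<Longrightarrow> \<exists>L\<ge>0. \<forall>x. norm x \<le> R \<longrightarrow>
      \<Phi>' x (F x) \<le> \<epsilon> + L * (norm (\<pi> (F x)))\<^sup>2 - speed x"
  shows "((\<lambda>t. speed (x t)) \<longlongrightarrow> 0) at_top"
proof -
  have dx: "(x has_vector_derivative F (x t)) (at t)" if "t > 0" for t
    using x[of t] that at_within_interior[of t "{0..}"] by (simp add: interior_real_atLeast)
  have cont_x: "continuous_on {0..} x"
    by (intro continuous_on_vector_derivative[of _ x "\<lambda>t. F (x t)"] x) simp
  have cont_speed: "continuous_on {0..} (\<lambda>t. speed (x t))"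
    unfolding speed_def by (intro curve_intros cont_x)
  have decreasing: "speed (x t) \<le> speed (x s)" if "0 \<le> s" "s \<le> t" for s t
  proof (rule DERIV_nonpos_imp_decreasing_open[OF that(2), of "\<lambda>t. speed (x t)"])
    show "continuous_on {s..t} (\<lambda>t. speed (x t))" using that by (intro continuous_on_subset[OF cont_speed]) auto
    fix r assume "s < r" "r < t"
    then have "((\<lambda>t. speed (x t)) has_real_derivative rate (x r) (F (x r))) (at r)"
      using that by (intro speed_derivative dx) auto
    moreover have "rate (x r) (F (x r)) \<le> 0"
      using contraction[of "x r" "F (x r)"] c_pos by (smt (verit) mult_nonneg_nonneg mult_minus_left zero_le_power2)
    ultimately show "\<exists>y. ((\<lambda>t. speed (x t)) has_real_derivative y) (at r) \<and> y \<le> 0" by blast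
  qed
  obtain R where R: "\<And>t. t \<ge> 0 \<Longrightarrow> norm (x t) \<le> R"
    using bounded unfolding bounded_iff by auto
  have "continuous_on (cball 0 R) \<Phi>"
    using has_derivative_continuous_on[OF has_derivative_at_withinI[OF \<Phi>]] .
  then have "bounded (\<Phi> ` cball 0 R)" by (intro compact_imp_bounded compact_continuous_image) auto
  then obtain C where "\<forall>x\<in>cball 0 R. \<bar>\<Phi> x\<bar> \<le> C" unfolding bounded_iff by auto
  then have C: "\<bar>\<Phi> (x t)\<bar> \<le> C" if "t \<ge> 0" for t using R[OF that] by simp
  show ?thesis
  proof (rule tendstoI)
    fix e :: real assume "e > 0"
    \<comment> \<open>The \<open>O(1 / T)\<close> term drops below \<open>\<epsilon>\<close> for
      large \<open>T\<close>, so the speed ends up at most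
      \<open>2 * \<epsilon> = e / 2\<close>.\<close>
    define \<epsilon> where "\<epsilon> = e / 4"
    have \<epsilon>: "\<epsilon> > 0" using \<open>e > 0\<close> by (simp add: \<epsilon>_def)
    obtain L where L: "L \<ge> 0" "\<And>x. norm x \<le> R \<Longrightarrow> \<Phi>' x (F x) \<le> \<epsilon> + L * (norm (\<pi> (F x)))\<^sup>2 - speed x"
      using dissipation[OF \<epsilon>, of R] by blast
    \<comment> \<open>With the factor \<open>L / c\<close>, the contraction term
      \<open>- c |\<pi> F|^2\<close> in the derivative of the speed cancels the \<open>L\<close>
      term of the dissipation bound.\<close>
    define W where "W t = \<Phi> (x t) + L / c * speed (x t)" for t
    have dW: "(W has_real_derivative \<Phi>' (x t) (F (x t)) + L / c * rate (x t) (F (x t))) (at t)" if "t > 0" for t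
    proof -
      have "((\<Phi> \<circ> x) has_vector_derivative \<Phi>' (x t) (F (x t))) (at t)"
        using vector_derivative_diff_chain_within[OF dx[OF that] has_derivative_at_withinI[OF \<Phi>]] .
      then have "((\<lambda>t. \<Phi> (x t)) has_real_derivative \<Phi>' (x t) (F (x t))) (at t)"
        by (simp add: o_def has_real_derivative_iff_has_vector_derivative)
      then show ?thesis unfolding W_def
        by (intro DERIV_add DERIV_cmult speed_derivative dx that)
    qed
    have cont_W: "continuous_on {0..} W"
    proof -
      have "continuous_on {0..} (\<lambda>t. \<Phi> (x t))"
        using continuous_on_compose2[OF has_derivative_continuous_on[OF \<Phi>] cont_x] by auto
      then show ?thesis unfolding W_def by (intro continuous_intros cont_speed)
    qed
    have key: "T * speed (x T) \<le> T * \<epsilon> + (2 * C + L / c * speed (x 0))" if T: "T > 0" for T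
    proof -
      have "continuous_on {0..T} W" by (rule continuous_on_subset[OF cont_W]) auto
      moreover have "W differentiable (at t)" if "0 < t" "t < T" for t
        using dW[of t] that by (auto simp: real_differentiable_def)
      ultimately obtain l z where z: "0 < z" "z < T" "(W has_real_derivative l) (at z)" "W T - W 0 = (T - 0) * l"
        using MVT[OF T] by blast
      have "l = \<Phi>' (x z) (F (x z)) + L / c * rate (x z) (F (x z))"
        using DERIV_unique[OF z(3) dW] z(1) by blast
      also have "\<dots> \<le> (\<epsilon> + L * (norm (\<pi> (F (x z))))\<^sup>2 - speed (x z)) + L / c * (- c * (norm (\<pi> (F (x z))))\<^sup>2)"
        using z R[of z] L c_pos contraction by (intro add_mono mult_left_mono L(2)) auto
      also have "\<dots> = \<epsilon> - speed (x z)" using c_pos by simp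
      also have "\<dots> \<le> \<epsilon> - speed (x T)" using decreasing[of z T] z by simp
      finally have "T * l \<le> T * (\<epsilon> - speed (x T))" using T by (intro mult_left_mono) auto
      then have "W T - W 0 \<le> T * (\<epsilon> - speed (x T))" using z(4) by simp
      moreover have "- W T \<le> C" "W 0 \<le> C + L / c * speed (x 0)"
        using C[of T] C[of 0] T L c_pos speed_nonneg[of "x T"]
        by (auto simp: W_def intro: order_trans[of _ "- \<Phi> (x T)"])
      ultimately show ?thesis by (simp add: algebra_simps)
    qed
    have "\<forall>\<^sub>F T in at_top. T > max 0 ((2 * C + L / c * speed (x 0)) / \<epsilon>)" by (rule eventually_gt_at_top)
    then show "\<forall>\<^sub>F T in at_top. dist (speed (x T)) 0 < e"
    proof eventually_elim
      case (elim T)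
      then have T: "T > 0" "2 * C + L / c * speed (x 0) < T * \<epsilon>" using \<epsilon> by (auto simp: field_simps)
      moreover have "T * (2 * \<epsilon>) = T * \<epsilon> + T * \<epsilon>" by simp
      ultimately have "T * speed (x T) \<le> T * (2 * \<epsilon>)" using key[OF T(1)] by linarith
      then have "speed (x T) \<le> 2 * \<epsilon>" using T by simp
      also have "\<dots> < e" using \<open>e > 0\<close> by (simp add: \<epsilon>_def)
      finally show ?case using speed_nonneg[of "x T"] by (simp add: dist_real_def)
    qed
  qed
qed

text \<open>Closeness at a single time of the convergent subsequence suffices:
  \<open>min_energy p\<close> does not increase afterwards, and it is comparable to the squared
  Euclidean distance, from above near \<open>p\<close> and from below everywhere.\<close>

lemma bounded_solution_converges:
  assumes x: "\<And>t. t \<ge> 0 \<Longrightarrow> (x has_vector_derivative F (x t)) (at t within {0..})"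
    and bounded: "bounded (x ` {0..})"
    and speed: "((\<lambda>t. speed (x t)) \<longlongrightarrow> 0) at_top"
  obtains p where "F p = 0" "(x \<longlongrightarrow> p) at_top"
proof -
  have "bounded (range (\<lambda>n. x (real n)))" by (rule bounded_subset[OF bounded]) auto
  then obtain p r where r: "strict_mono (r :: nat \<Rightarrow> nat)" "((\<lambda>n. x (real n)) \<circ> r) \<longlonglongrightarrow> p"
    using bounded_imp_convergent_subsequence by blast
  then have lim: "(\<lambda>n. x (real (r n))) \<longlonglongrightarrow> p" by (simp add: o_def)
  have tends: "filterlim (\<lambda>n. real (r n)) at_top sequentially"
    using filterlim_compose[OF filterlim_real_sequentially filterlim_subseq[OF r(1)]] .
  have "continuous_on UNIV speed" unfolding speed_def
    by (intro curve_intros continuous_on_id)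
  then have "(\<lambda>n. speed (x (real (r n)))) \<longlonglongrightarrow> speed p"
    using lim by (intro continuous_on_tendsto_compose[where f = speed and s = UNIV]) auto
  moreover have "(\<lambda>n. speed (x (real (r n)))) \<longlonglongrightarrow> 0"
    using filterlim_compose[OF speed tends] .
  ultimately have "speed p = 0" by (rule LIMSEQ_unique)
  then have "\<beta> * (norm (F p))\<^sup>2 \<le> 0" using coercive[of "F p" p] by (simp add: speed_def)
  then have p: "F p = 0" using beta_pos by (simp add: mult_le_0_iff)
  have decreasing: "min_energy p (x t) \<le> min_energy p (x s)" if "0 \<le> s" "s \<le> t" for s t
    using that by (intro min_energy_decreasing[OF p] has_vector_derivative_within_subset[OF x]) auto
  have "(x \<longlongrightarrow> p) at_top"
  proof (rule tendstoI)
    fix e :: real assume e: "e > 0"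
    obtain K where "K \<ge> 1" and "\<And>x. norm x \<le> norm p + 1 \<Longrightarrow>
        norm (G x) \<le> K \<and> norm (G' x) \<le> K \<and> norm (F x) \<le> K \<and> norm (F' x) \<le> K"
      by (rule bounds_on_ball[of "norm p + 1"]) blast
    then have K: "K \<ge> 1" "\<And>x. norm x \<le> norm p + 1 \<Longrightarrow> norm (G x) \<le> K" by simp_all
    \<comment> \<open>The \<open>1\<close> keeps the point in the ball on which \<open>K\<close>
      bounds the metric; the root makes \<open>K d^2\<close> at most
      \<open>\<beta> e^2 / 2\<close>.\<close>
    define d where "d = min 1 (sqrt (\<beta> * e\<^sup>2 / (2 * K)))"
    have d: "d > 0" using beta_pos e K by (simp add: d_def)
    obtain n where "dist (x (real (r n))) p < d"
      using metric_LIMSEQ_D[OF lim d] by blast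
    then have n: "norm (x (real (r n)) - p) < d" by (simp add: dist_norm)
    have "norm (x (real (r n))) \<le> norm p + norm (x (real (r n)) - p)"
      using norm_triangle_ineq[of p "x (real (r n)) - p"] by simp
    then have "norm (x (real (r n))) \<le> norm p + 1" using n by (simp add: d_def)
    then have "min_energy p (x (real (r n))) \<le> K * (norm (x (real (r n)) - p))\<^sup>2"
      by (intro min_energy_le_norm[where R = "norm p + 1"] K(2)) auto
    also have "\<dots> \<le> K * (sqrt (\<beta> * e\<^sup>2 / (2 * K)))\<^sup>2"
      using n K(1) by (intro mult_left_mono power_mono) (auto simp: d_def)
    also have "\<dots> = \<beta> * (e\<^sup>2 / 2)" using K(1) beta_pos by simp
    finally have small: "min_energy p (x (real (r n))) \<le> \<beta> * (e\<^sup>2 / 2)" .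
    have "dist (x t) p < e" if "t \<ge> real (r n)" for t
    proof -
      have "\<beta> * (norm (x t - p))\<^sup>2 \<le> \<beta> * (e\<^sup>2 / 2)"
        using norm_diff_le_min_energy[of "x t" p] decreasing[OF _ that] small by linarith
      then have "(norm (x t - p))\<^sup>2 \<le> e\<^sup>2 / 2" using beta_pos by simp
      also have "\<dots> < e\<^sup>2" using e by simp
      finally show ?thesis using e by (simp add: dist_norm power2_less_imp_less)
    qed
    then show "\<forall>\<^sub>F t in at_top. dist (x t) p < e"
      unfolding eventually_at_top_linorder by blast
  qed
  with p show ?thesis by (rule that)
qed

end

section \<open>Continuation of solutions\<close>

text \<open>Picard iteration for \<open>F\<close> composed with the nearest-point projection
  \<open>P\<close> onto the unit ball about \<open>x0\<close>, which is Lipschitz on the whole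
  space. Up to time \<open>1 / B\<close> the fixed point cannot leave the ball, where
  \<open>P\<close> is the identity; \<open>\<delta> \<le> 1 / (2 L)\<close> makes the iteration a
  contraction.\<close>

lemma local_solution:
  fixes F :: "'a::euclidean_space \<Rightarrow> 'a"
  assumes F: "has_C1_derivative F F'"
  obtains \<delta> z where "\<delta> > 0" "z 0 = x0"
    "\<And>t. t \<in> {0..\<delta>} \<Longrightarrow> (z has_vector_derivative F (z t)) (at t within {0..\<delta>})"
proof -
  let ?S = "cball x0 1"
  have "bounded (F ` ?S)" "bounded (F' ` ?S)"
    by (intro compact_imp_bounded compact_continuous_image C1_continuous[OF F]
        C1_continuous_derivative[OF F] compact_cball)+
  then obtain B L where B: "B > 0" "\<And>x. x \<in> ?S \<Longrightarrow> norm (F x) \<le> B"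
    and L: "L > 0" "\<And>x. x \<in> ?S \<Longrightarrow> norm (F' x) \<le> L"
    unfolding bounded_pos by auto
  define P where "P = closest_point ?S"
  have P: "P x \<in> ?S" "x \<in> ?S \<Longrightarrow> P x = x" "dist (P x) (P y) \<le> dist x y" for x y
    unfolding P_def by (auto intro: closest_point_lipschitz simp: closest_point_self
        intro!: closest_point_in_set[THEN subsetD[OF subset_refl]] simp del: mem_cball)
  have lip: "norm (F (P x) - F (P y)) \<le> L * dist x y" for x y
  proof -
    have "norm (F (P x) - F (P y)) \<le> L * norm (P x - P y)"
      using L(2) P(1) by (intro differentiable_bound[of ?S F "\<lambda>x. blinfun_apply (F' x)"])
        (auto intro: C1_has_derivative[OF F] simp: norm_blinfun.rep_eq simp del: mem_cball)
    also have "\<dots> \<le> L * dist x y" using P(3)[of x y] L(1) by (intro mult_left_mono) (auto simp: dist_norm)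
    finally show ?thesis .
  qed
  have cont: "continuous_on S (\<lambda>s. F (P (y s)))" if "continuous_on S y" for S and y :: "real \<Rightarrow> 'a"
  proof -
    have "continuous_on UNIV P" unfolding P_def by (intro continuous_on_closest_point) auto
    then show ?thesis
      using that by (intro continuous_on_compose2[OF C1_continuous[OF F, of UNIV]]
        continuous_on_compose2[of UNIV P S y]) auto
  qed
  define \<delta> where "\<delta> = min (1 / B) (1 / (2 * L))"
  have \<delta>: "\<delta> > 0" "\<delta> * B \<le> 1" "\<delta> * L \<le> 1 / 2"
    using B(1) L(1) by (auto simp: \<delta>_def min_def field_simps)
  \<comment> \<open>Clamping the time to \<open>{0..\<delta>}\<close> extends the Picard integral to
    a bounded continuous function on the line, so the fixed point is sought in a complete
    space.\<close>
  have "\<exists>g. \<forall>t. apply_bcontfun g t = x0 + integral {0..clamp 0 \<delta> t} (\<lambda>s. F (P (y s)))"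
    for y :: "real \<Rightarrow>\<^sub>C 'a"
  proof -
    have "continuous_on (cbox 0 \<delta>) (\<lambda>t. x0 + integral {0..t} (\<lambda>s. F (P (y s))))"
      unfolding cbox_interval
      by (intro continuous_intros indefinite_integral_continuous_1 integrable_continuous_interval cont) auto
    then show ?thesis by (rule continuous_on_cbox_bcontfunE) metis
  qed
  then obtain \<T> :: "(real \<Rightarrow>\<^sub>C 'a) \<Rightarrow> (real \<Rightarrow>\<^sub>C 'a)" where \<T>:
    "\<And>y t. \<T> y t = x0 + integral {0..clamp 0 \<delta> t} (\<lambda>s. F (P (y s)))" by metis
  have clamp: "clamp 0 \<delta> t \<in> {0..\<delta>}" for t using clamp_in_interval[of 0 \<delta> t] \<delta>(1) by simp
  have "dist (\<T> y) (\<T> z) \<le> 1 / 2 * dist y z" for y z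
  proof (rule dist_bound)
    fix t
    define u where "u = clamp 0 \<delta> t"
    have u: "0 \<le> u" "u \<le> \<delta>" using clamp[of t] by (auto simp: u_def)
    have int: "(\<lambda>s. F (P (y s))) integrable_on {0..u}" for y :: "real \<Rightarrow>\<^sub>C 'a"
      by (intro integrable_continuous_interval cont) auto
    have "dist (\<T> y t) (\<T> z t) = norm (integral {0..u} (\<lambda>s. F (P (y s)) - F (P (z s))))"
      unfolding \<T> u_def[symmetric] by (simp add: dist_norm integral_diff int)
    also have "\<dots> \<le> integral {0..u} (\<lambda>s. L * dist y z)"
    proof (rule integral_norm_bound_integral)
      fix s
      have "L * dist (y s) (z s) \<le> L * dist y z" using dist_bounded[of y s z] L(1) by simp
      then show "norm (F (P (y s)) - F (P (z s))) \<le> L * dist y z" using lip[of "y s" "z s"] by simp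
    qed (auto intro!: integrable_diff int)
    also have "\<dots> = u * L * dist y z" using u by simp
    also have "\<dots> \<le> \<delta> * L * dist y z" using u L by (intro mult_right_mono) auto
    also have "\<dots> \<le> 1 / 2 * dist y z" using \<delta> by (intro mult_right_mono) auto
    finally show "dist (\<T> y t) (\<T> z t) \<le> 1 / 2 * dist y z" .
  qed
  then obtain y where "\<T> y = y"
    using banach_fix_type[of "1/2" \<T>] by auto
  then have y: "y t = x0 + integral {0..t} (\<lambda>s. F (P (y s)))" if "t \<in> {0..\<delta>}" for t
    using \<T>[of y t] that by (simp add: clamp_cancel_cbox)
  have y_in: "P (y t) = y t" if t: "t \<in> {0..\<delta>}" for t
  proof (rule P(2))
    have "norm (integral {0..t} (\<lambda>s. F (P (y s)))) \<le> integral {0..t} (\<lambda>s. B)"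
      by (intro integral_norm_bound_integral integrable_continuous_interval cont B P) auto
    also have "\<dots> \<le> \<delta> * B" using t B by (simp add: mult_right_mono)
    finally show "y t \<in> ?S" using y[OF t] \<delta>(2) by (simp add: dist_norm)
  qed
  show ?thesis
  proof (rule that[OF \<delta>(1), of "apply_bcontfun y"])
    show "y 0 = x0" using y[of 0] \<delta>(1) by simp
    fix t assume t: "t \<in> {0..\<delta>}"
    have "((\<lambda>t. x0 + integral {0..t} (\<lambda>s. F (P (y s)))) has_vector_derivative 0 + F (P (y t))) (at t within {0..\<delta>})"
      by (intro has_vector_derivative_add integral_has_vector_derivative cont t) auto
    then show "(y has_vector_derivative F (y t)) (at t within {0..\<delta>})"
      unfolding y_in[OF t] using t y
      by (intro has_vector_derivative_transform[of t "{0..\<delta>}" y]) auto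
  qed
qed

text \<open>Meant for the junction of two solutions, where the derivative is not known beforehand.
  Integrating across finitely many such times yields the integral equation, whose right side is
  differentiable everywhere.\<close>

lemma solution_extend_by_integral:
  fixes y :: "real \<Rightarrow> 'a::banach"
  assumes F: "continuous_on UNIV F" and y: "continuous_on {0..c} y" and "finite S"
    and deriv: "\<And>t. t \<in> {0<..<c} - S \<Longrightarrow> (y has_vector_derivative F (y t)) (at t)"
    and t: "t \<in> {0..c}"
  shows "(y has_vector_derivative F (y t)) (at t within {0..c})"
proof -
  have cont: "continuous_on {0..c} (\<lambda>t. F (y t))"
    by (rule continuous_on_compose2[OF F y]) auto
  have eq: "y s = y 0 + integral {0..s} (\<lambda>t. F (y t))" if s: "s \<in> {0..c}" for s
  proof -
    have "((\<lambda>t. F (y t)) has_integral (y s - y 0)) {0..s}"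
    proof (rule fundamental_theorem_of_calculus_interior_strong[OF \<open>finite S\<close>])
      show "continuous_on {0..s} y" using s by (intro continuous_on_subset[OF y]) auto
      show "(y has_vector_derivative F (y t)) (at t)" if "t \<in> {0<..<s} - S" for t
        using that s by (intro deriv) auto
    qed (use s in auto)
    then show ?thesis by (simp add: integral_unique)
  qed
  have "((\<lambda>s. y 0 + integral {0..s} (\<lambda>t. F (y t))) has_vector_derivative 0 + F (y t)) (at t within {0..c})"
    by (intro has_vector_derivative_add integral_has_vector_derivative cont t) auto
  then show ?thesis
    using has_vector_derivative_transform[OF t eq] by simp
qed

text \<open>On a finite lifetime a bounded solution has bounded velocity, hence is Lipschitz and has
  a limit at the end time; a local solution started there continues it, against maximality.\<close>

lemma bounded_trajectory_global:
  fixes F :: "'a::euclidean_space \<Rightarrow> 'a"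
  assumes F: "has_C1_derivative F F'" and traj: "trajectory F T x" and bounded: "bounded (x ` time_domain T)"
  shows "T = \<infinity>"
proof (rule ccontr)
  assume "T \<noteq> \<infinity>"
  moreover have sol: "solution F T x" using traj by (simp add: trajectory_def)
  ultimately obtain b where b: "T = ereal b" "b > 0"
    by (cases T) (auto simp: solution_def zero_ereal_def)
  have dom: "time_domain (ereal c) = {0..<c}" for c by (auto simp: time_domain_def)
  have x: "(x has_vector_derivative F (x t)) (at t within {0..<b})" if "t \<in> {0..<b}" for t
    using sol that b dom by (auto simp: solution_def)
  obtain R where R: "\<And>t. t \<in> {0..<b} \<Longrightarrow> norm (x t) \<le> R"
    using bounded unfolding bounded_iff b dom by (metis imageI)
  have "bounded (F ` cball 0 R)"
    by (intro compact_imp_bounded compact_continuous_image C1_continuous[OF F] compact_cball)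
  then obtain B where "\<forall>x\<in>cball 0 R. norm (F x) \<le> B" unfolding bounded_iff by auto
  then have B: "norm (F x) \<le> B" if "norm x \<le> R" for x using that by simp
  have "norm (F (x 0)) \<le> B" using b by (intro B R) simp
  then have B0: "0 \<le> B" by (rule order_trans[OF norm_ge_zero])
  have "B-lipschitz_on {0..<b} x"
  proof (rule bounded_derivative_imp_lipschitz)
    show "0 \<le> B" by (rule B0)
    fix t assume t: "t \<in> {0..<b}"
    show "(x has_derivative (\<lambda>h. h *\<^sub>R F (x t))) (at t within {0..<b})"
      using x[OF t] by (simp add: has_vector_derivative_def)
    show "onorm (\<lambda>h. h *\<^sub>R F (x t)) \<le> B"
      using B[OF R[OF t]] B0
      by (intro onorm_bound) (auto simp: mult.commute[of B] intro!: mult_left_mono)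
  qed auto
  then have "uniformly_continuous_on {0..<b} x" by (rule lipschitz_on_uniformly_continuous)
  moreover have "b \<in> closure {0..<b}" using b by simp
  ultimately obtain l where l: "(x \<longlongrightarrow> l) (at b within {0..<b})"
    by (rule uniformly_continuous_on_extension_at_closure)
  obtain \<delta> z where \<delta>: "\<delta> > 0" "z 0 = l" and
    z: "\<And>t. t \<in> {0..\<delta>} \<Longrightarrow> (z has_vector_derivative F (z t)) (at t within {0..\<delta>})"
    using local_solution[OF F] by metis
  \<comment> \<open>At \<open>t = b\<close> the second branch applies and gives
    \<open>z 0 = l\<close>, the limit of \<open>x\<close>.\<close>
  define y where "y t = (if t < b then x t else z (t - b))" for t
  have "continuous_on {0..b} y"
    unfolding continuous_on_def
  proof
    fix t assume t: "t \<in> {0..b}"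
    show "(y \<longlongrightarrow> y t) (at t within {0..b})"
    proof (cases "t = b")
      case True
      have "{0..b} - {b} = {0..<b} - {b}" by auto
      then have "at b within {0..b} = at b within {0..<b}" by (simp add: at_within_def)
      with l have "(x \<longlongrightarrow> l) (at b within {0..b})" by simp
      then have "(y \<longlongrightarrow> l) (at b within {0..b})"
        by (rule Lim_transform_eventually) (auto simp: y_def eventually_at_filter)
      then show ?thesis using True \<delta> by (simp add: y_def)
    next
      case False
      have "continuous_on {0..<b} x"
        by (rule continuous_on_vector_derivative[of _ x "\<lambda>t. F (x t)"]) (rule x)
      then have "(x \<longlongrightarrow> x t) (at t within {0..<b})" using t False by (auto simp: continuous_on_def)
      moreover have "at t within {0..<b} = at t within {0..b}"
        using t False by (intro at_within_nhd[of t "{..<b}"]) auto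
      ultimately have "(x \<longlongrightarrow> x t) (at t within {0..b})" by simp
      moreover have "\<forall>\<^sub>F s in at t within {0..b}. x s = y s"
        using t False order_tendstoD(2)[OF tendsto_ident_at, of t b "{0..b}"]
        by (auto simp: y_def elim: eventually_mono)
      ultimately have "(y \<longlongrightarrow> x t) (at t within {0..b})" by (rule Lim_transform_eventually)
      then show ?thesis using t False by (simp add: y_def)
    qed
  qed
  moreover have "continuous_on {b..b + \<delta>} y"
  proof -
    have "continuous_on {0..\<delta>} z"
      by (rule continuous_on_vector_derivative[of _ z "\<lambda>t. F (z t)"]) (rule z)
    then have "continuous_on {b..b + \<delta>} (\<lambda>t. z (t - b))"
      by (rule continuous_on_compose2) (auto intro!: continuous_intros)
    then show ?thesis by (rule continuous_on_eq) (auto simp: y_def)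
  qed
  ultimately have "continuous_on ({0..b} \<union> {b..b + \<delta>}) y" by (intro continuous_on_closed_Un) auto
  moreover have "{0..b} \<union> {b..b + \<delta>} = {0..b + \<delta>}" using b \<delta> by auto
  ultimately have cont: "continuous_on {0..b + \<delta>} y" by simp
  have deriv: "(y has_vector_derivative F (y t)) (at t)" if "t \<in> {0<..<b + \<delta>} - {b}" for t
  proof (cases "t < b")
    case True
    have "(x has_vector_derivative F (x t)) (at t within {0<..<b})"
      using that True by (intro has_vector_derivative_within_subset[OF x]) auto
    then have "(x has_vector_derivative F (x t)) (at t)"
      using that True by (simp add: at_within_open[of t "{0<..<b}"])
    then have "(y has_vector_derivative F (x t)) (at t)"
      by (rule has_vector_derivative_transform_within_open[where S = "{0<..<b}"])
        (use that True in \<open>auto simp: y_def\<close>)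
    then show ?thesis using True by (simp add: y_def)
  next
    case False
    have "(z has_vector_derivative F (z (t - b))) (at (t - b) within {0<..<\<delta>})"
      using that False by (intro has_vector_derivative_within_subset[OF z]) auto
    then have "(z has_vector_derivative F (z (t - b))) (at (t - b))"
      using that False by (simp add: at_within_open[of "t - b" "{0<..<\<delta>}"])
    then have "((z \<circ> (\<lambda>t. t - b)) has_vector_derivative 1 *\<^sub>R F (z (t - b))) (at t)"
      by (intro vector_diff_chain_at) (simp_all add: has_vector_derivative_diff_const)
    then have "((\<lambda>t. z (t - b)) has_vector_derivative F (z (t - b))) (at t)" by (simp add: o_def)
    then have "(y has_vector_derivative F (z (t - b))) (at t)"
      by (rule has_vector_derivative_transform_within_open[where S = "{b<..<b + \<delta>}"])
        (use that False in \<open>auto simp: y_def\<close>)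
    then show ?thesis using False by (simp add: y_def)
  qed
  have "(y has_vector_derivative F (y t)) (at t within {0..<b + \<delta>})" if "t \<in> {0..<b + \<delta>}" for t
    using that by (intro has_vector_derivative_within_subset[OF
          solution_extend_by_integral[where S = "{b}", OF C1_continuous[OF F] cont _ deriv]]) auto
  then have "solution F (ereal (b + \<delta>)) y"
    using b \<delta> by (auto simp: solution_def dom zero_ereal_def)
  moreover have "\<forall>t\<in>time_domain T. y t = x t" by (simp add: b dom y_def)
  moreover have "T < ereal (b + \<delta>)" using b \<delta> by simp
  ultimately show False using traj unfolding trajectory_def by blast
qed

section \<open>Gradient fields of a matrix metric\<close>

definition matrix_blinfun :: "real^'n::finite^'m::finite \<Rightarrow> ((real^'n) \<Rightarrow>\<^sub>L (real^'m))" where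
  "matrix_blinfun A = Blinfun ((*v) A)"

lemma matrix_blinfun_apply [simp]: "blinfun_apply (matrix_blinfun A) v = A *v v"
  by (simp add: matrix_blinfun_def bounded_linear_Blinfun_apply matrix_vector_mul_bounded_linear)

lemma bounded_linear_matrix_blinfun: "bounded_linear matrix_blinfun"
  by (subst linear_conv_bounded_linear[symmetric], rule linearI)
    (auto intro!: blinfun_eqI simp: blinfun.bilinear_simps matrix_vector_mult_add_rdistrib
      scaleR_matrix_vector_assoc)

lemma partial_deriv_eq:
  assumes "(f has_derivative f') (at x)"
  shows "partial_deriv i f x = f' (axis i 1)"
  unfolding partial_deriv_def using frechet_derivative_at[OF assms] by simp

lemma gradient_eq:
  assumes "(f has_derivative (\<lambda>v. g \<bullet> v)) (at x)"
  shows "gradient f x = g"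
  by (simp add: gradient_def partial_deriv_eq[OF assms] vec_eq_iff inner_axis)

lemma uniformly_positive_definite_coercive:
  assumes "uniformly_positive_definite M"
  obtains \<beta> where "\<beta> > 0" "\<And>x v. \<beta> * (norm v)\<^sup>2 \<le> v \<bullet> (M x *v v)"
  using assms unfolding uniformly_positive_definite_def loewner_ge_def positive_semidefinite_def
  by (auto simp: matrix_vector_mult_diff_rdistrib inner_diff_right scaleR_matrix_vector_assoc[symmetric]
      power2_norm_eq_inner)

lemma positive_definite_symmetric:
  assumes "positive_definite A"
  shows "v \<bullet> (A *v w) = w \<bullet> (A *v v)"
  using assms unfolding positive_definite_def
  by (metis dot_lmul_matrix inner_commute transpose_matrix_vector)

lemma positive_definite_inverse:
  assumes "positive_definite A"
  shows "A *v (matrix_inv A *v v) = v" "transpose (matrix_inv A) = matrix_inv A"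
proof -
  have "\<forall>v. A *v v = 0 \<longrightarrow> v = 0"
    using assms unfolding positive_definite_def by (metis inner_zero_right less_irrefl)
  then have "invertible A"
    using invertible_left_inverse matrix_left_invertible_ker by blast
  then have inv: "A ** matrix_inv A = mat 1" "matrix_inv A ** A = mat 1"
    unfolding invertible_def matrix_inv_def by (metis (mono_tags, lifting) someI_ex)+
  then show "A *v (matrix_inv A *v v) = v" by (simp add: matrix_vector_mul_assoc)
  have "transpose (matrix_inv A) ** A = mat 1"
    using arg_cong[OF inv(1), of transpose] assms
    by (simp add: matrix_transpose_mul positive_definite_def)
  then have "transpose (matrix_inv A) ** (A ** matrix_inv A) = matrix_inv A"
    by (simp add: matrix_mul_assoc)
  then show "transpose (matrix_inv A) = matrix_inv A" by (simp add: inv)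
qed

lemma matrix_quadratic_form:
  fixes A :: "real^'n::finite^'m::finite"
  shows "v \<bullet> (A *v w) = (\<Sum>i\<in>UNIV. \<Sum>j\<in>UNIV. v $ i * w $ j * A $ i $ j)"
  by (simp add: inner_vec_def matrix_vector_mult_def sum_distrib_left mult_ac)

lemma linear_axis_sum:
  fixes L :: "real^'n::finite \<Rightarrow> 'b::real_vector"
  assumes "linear L"
  shows "L v = (\<Sum>i\<in>UNIV. v $ i *\<^sub>R L (axis i 1))"
proof -
  have "L v = L (\<Sum>i\<in>UNIV. v $ i *\<^sub>R axis i 1)" using basis_expansion[of v] by (simp add: scalar_mult_eq_scaleR)
  then show ?thesis by (simp add: linear_sum[OF assms] linear_scale[OF assms])
qed

text \<open>The Hessian is half the Lie derivative of the metric along the Riemannian gradient,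
  which is \<open>- F\<close>: in view of \<open>M F' v = - H v - M' v F\<close>, the right side is
  \<open>- 1 / 2\<close> times \<open>rate\<close>. With \<open>v\<close> in both slots the first
  two terms of the Christoffel symbol coincide, and contracting its upper index with the partial
  derivatives produces \<open>- F\<close>.\<close>

lemma riemannian_hessian_quadratic_form:
  fixes M :: "real^'n::finite \<Rightarrow> real^'n^'n"
  assumes M: "(M has_derivative M') (at x)" and g: "(gradient f has_derivative H) (at x)"
    and pd: "positive_definite (M x)"
  defines "F \<equiv> - (matrix_inv (M x) *v gradient f x)"
  shows "v \<bullet> (riemannian_hessian M f x *v v)
    = v \<bullet> H v + v \<bullet> (M' v *v F) - 1 / 2 * (v \<bullet> (M' F *v v))"
proof -
  let ?N = "matrix_inv (M x)"
  define D where "D j i k = M' (axis j 1) $ i $ k" for j i k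
  have D: "partial_deriv j (\<lambda>y. M y $ i $ k) x = D j i k" for i j k
    unfolding D_def
    by (rule partial_deriv_eq)
      (intro bounded_linear.has_derivative[OF bounded_linear_vec_nth]
        bounded_linear.has_derivative[OF bounded_linear_vec_nth] M)
  have lin: "linear M'" "linear H" using M g has_derivative_linear by blast+
  have M'_eq: "M' v $ i $ k = (\<Sum>j\<in>UNIV. v $ j * D j i k)" for v i k
    by (subst linear_axis_sum[OF lin(1)]) (simp add: D_def)
  have P: "partial_deriv j f = (\<lambda>x. gradient f x $ j)" for j
    by (simp add: gradient_def fun_eq_iff)
  have PP: "partial_deriv i (partial_deriv j f) x = H (axis i 1) $ j" for i j
    unfolding P by (rule partial_deriv_eq) (intro bounded_linear.has_derivative[OF bounded_linear_vec_nth] g)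
  \<comment> \<open>The sum runs over the first index of the inverse, so its symmetry
    enters.\<close>
  have N: "(\<Sum>m\<in>UNIV. ?N $ m $ k * partial_deriv m f x) = - F $ k" for k
  proof -
    have "(\<Sum>m\<in>UNIV. ?N $ m $ k * partial_deriv m f x) = (transpose ?N *v gradient f x) $ k"
      by (simp add: matrix_vector_mult_def transpose_def P)
    then show ?thesis by (simp add: F_def positive_definite_inverse[OF pd])
  qed
  have \<Gamma>: "(\<Sum>m\<in>UNIV. christoffel M m i j x * partial_deriv m f x)
      = - 1 / 2 * (\<Sum>k\<in>UNIV. F $ k * (D j i k + D i j k - D k i j))" for i j
  proof -
    have "(\<Sum>m\<in>UNIV. christoffel M m i j x * partial_deriv m f x)
      = (\<Sum>m\<in>UNIV. \<Sum>k\<in>UNIV. 1 / 2 * (D j i k + D i j k - D k i j) * (?N $ m $ k * partial_deriv m f x))"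
      unfolding christoffel_def D by (simp add: sum_distrib_left sum_distrib_right mult_ac)
    also have "\<dots> = (\<Sum>k\<in>UNIV. 1 / 2 * (D j i k + D i j k - D k i j) * (\<Sum>m\<in>UNIV. ?N $ m $ k * partial_deriv m f x))"
      by (subst sum.swap) (simp only: sum_distrib_left)
    also have "\<dots> = - 1 / 2 * (\<Sum>k\<in>UNIV. F $ k * (D j i k + D i j k - D k i j))"
      unfolding N sum_distrib_left by (intro sum.cong) auto
    finally show ?thesis .
  qed
  have "v \<bullet> (riemannian_hessian M f x *v v) = (\<Sum>i\<in>UNIV. \<Sum>j\<in>UNIV. v $ i * v $ j * H (axis i 1) $ j)
     + 1 / 2 * (\<Sum>i\<in>UNIV. \<Sum>j\<in>UNIV. v $ i * v $ j * (\<Sum>k\<in>UNIV. F $ k * (D j i k + D i j k - D k i j)))"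
  proof -
    define K where "K i j = (\<Sum>k\<in>UNIV. F $ k * (D j i k + D i j k - D k i j))" for i j
    have "riemannian_hessian M f x $ i $ j = H (axis i 1) $ j + 1 / 2 * K i j" for i j
      by (simp add: riemannian_hessian_def PP \<Gamma> K_def)
    then show ?thesis
      unfolding matrix_quadratic_form K_def[symmetric]
      by (simp add: algebra_simps sum.distrib sum_distrib_left)
  qed
  also have "(\<Sum>i\<in>UNIV. \<Sum>j\<in>UNIV. v $ i * v $ j * H (axis i 1) $ j) = v \<bullet> H v"
  proof -
    have "H v $ j = (\<Sum>i\<in>UNIV. v $ i * H (axis i 1) $ j)" for j
      by (subst linear_axis_sum[OF lin(2)]) simp
    then have "v \<bullet> H v = (\<Sum>j\<in>UNIV. \<Sum>i\<in>UNIV. v $ i * v $ j * H (axis i 1) $ j)"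
      by (simp add: inner_vec_def sum_distrib_left mult_ac)
    also have "\<dots> = (\<Sum>i\<in>UNIV. \<Sum>j\<in>UNIV. v $ i * v $ j * H (axis i 1) $ j)" by (rule sum.swap)
    finally show ?thesis by simp
  qed
  also have "(\<Sum>i\<in>UNIV. \<Sum>j\<in>UNIV. v $ i * v $ j * (\<Sum>k\<in>UNIV. F $ k * (D j i k + D i j k - D k i j)))
     = 2 * (v \<bullet> (M' v *v F)) - v \<bullet> (M' F *v v)"
  proof -
    have 1: "v \<bullet> (M' v *v F) = (\<Sum>i\<in>UNIV. \<Sum>j\<in>UNIV. \<Sum>k\<in>UNIV. v $ i * v $ j * F $ k * D j i k)"
    proof -
      have "(\<Sum>k\<in>UNIV. v $ i * F $ k * (\<Sum>j\<in>UNIV. v $ j * D j i k))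
          = (\<Sum>j\<in>UNIV. \<Sum>k\<in>UNIV. v $ i * v $ j * F $ k * D j i k)" for i
        by (subst sum.swap) (simp add: sum_distrib_left mult_ac)
      then show ?thesis unfolding matrix_quadratic_form M'_eq by simp
    qed
    have 2: "(\<Sum>i\<in>UNIV. \<Sum>j\<in>UNIV. \<Sum>k\<in>UNIV. v $ i * v $ j * F $ k * D i j k)
      = (\<Sum>i\<in>UNIV. \<Sum>j\<in>UNIV. \<Sum>k\<in>UNIV. v $ i * v $ j * F $ k * D j i k)"
      by (subst sum.swap) (simp add: mult_ac)
    have 3: "v \<bullet> (M' F *v v) = (\<Sum>i\<in>UNIV. \<Sum>j\<in>UNIV. \<Sum>k\<in>UNIV. v $ i * v $ j * F $ k * D k i j)"
      unfolding matrix_quadratic_form M'_eq by (simp add: sum_distrib_left mult_ac)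
    have "(\<Sum>i\<in>UNIV. \<Sum>j\<in>UNIV. v $ i * v $ j * (\<Sum>k\<in>UNIV. F $ k * (D j i k + D i j k - D k i j)))
      = (\<Sum>i\<in>UNIV. \<Sum>j\<in>UNIV. \<Sum>k\<in>UNIV. v $ i * v $ j * F $ k * D j i k)
      + (\<Sum>i\<in>UNIV. \<Sum>j\<in>UNIV. \<Sum>k\<in>UNIV. v $ i * v $ j * F $ k * D i j k)
      - (\<Sum>i\<in>UNIV. \<Sum>j\<in>UNIV. \<Sum>k\<in>UNIV. v $ i * v $ j * F $ k * D k i j)"
      by (simp add: sum_distrib_left sum.distrib[symmetric] sum_subtractf[symmetric] algebra_simps)
    then show ?thesis unfolding 1 2 3 by simp
  qed
  finally show ?thesis by simp
qed

text \<open>For the natural gradient field of \<open>f\<close>, \<open>rate\<close> is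
  \<open>- 2\<close> times the Riemannian Hessian, so convexity makes it nonpositive and the
  curve-pushing argument applies. It takes the place of convexity along a minimizing
  geodesic.\<close>

lemma critical_point_global_minimum:
  fixes M :: "real^'n::finite \<Rightarrow> real^'n^'n"
  assumes M: "C_class 1 M" "riemannian_metric M" "uniformly_positive_definite M"
    and f: "\<And>x. (f has_derivative (\<lambda>v. gradient f x \<bullet> v)) (at x)"
    and g: "has_C1_derivative (gradient f) H"
    and convex: "\<And>x v. 0 \<le> v \<bullet> (riemannian_hessian M f x *v v)"
    and p: "gradient f p = 0"
  shows "f p \<le> f q"
proof -
  obtain M' where M': "has_C1_derivative M M'" using C_class_1_derivative[OF M(1)] by blast
  obtain \<beta> where \<beta>: "\<beta> > 0" "\<And>x v. \<beta> * (norm v)\<^sup>2 \<le> v \<bullet> (M x *v v)"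
    using uniformly_positive_definite_coercive[OF M(3)] by blast
  define F where "F x = - (matrix_inv (M x) *v gradient f x)" for x
  define G where "G x = matrix_blinfun (M x)" for x
  define G' where "G' x = Blinfun matrix_blinfun o\<^sub>L M' x" for x
  have pd: "positive_definite (M x)" for x using M(2) by (simp add: riemannian_metric_def)
  have G: "has_C1_derivative G G'"
    unfolding G_def G'_def by (intro C1_bounded_linear[OF M' bounded_linear_matrix_blinfun])
  have G'_apply: "G' x v w = M' x v *v w" for x v w
    by (simp add: G'_def bounded_linear_Blinfun_apply bounded_linear_matrix_blinfun)
  have GF: "G x (F x) = - gradient f x" for x
    by (simp add: G_def F_def positive_definite_inverse[OF pd] linear_neg[OF matrix_vector_mul_linear])
  have coercive: "\<beta> * (norm v)\<^sup>2 \<le> v \<bullet> G x v" for x v by (simp add: G_def \<beta>)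
  have b: "has_C1_derivative (\<lambda>x. - gradient f x) (\<lambda>x. Blinfun uminus o\<^sub>L H x)"
    by (intro C1_bounded_linear[OF g] bounded_linear_minus bounded_linear_ident)
  obtain F' where F': "has_C1_derivative F F'"
    "\<And>x v. G x (F' x v) = (Blinfun uminus o\<^sub>L H x) v - G' x v (F x)"
    using coercive_solution_C1[OF \<beta>(1) coercive G b GF] by blast
  interpret riemannian_field G G' F F' \<beta>
  proof
    show "v \<bullet> G x w = w \<bullet> G x v" for v x w
      by (simp add: G_def positive_definite_symmetric[OF pd, of v x w])
  qed (use G F' \<beta> coercive in auto)
  show ?thesis
  proof (rule critical_point_minimal)
    show "F p = 0" by (simp add: F_def p)
    show "(f has_derivative (\<lambda>v. - (v \<bullet> G x (F x)))) (at x)" for x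
      using f[of x] by (simp add: GF inner_commute)
    fix x v
    have "v \<bullet> (riemannian_hessian M f x *v v) = v \<bullet> H x v + v \<bullet> (M' x v *v F x) - 1 / 2 * (v \<bullet> (M' x (F x) *v v))"
      unfolding F_def
      by (intro riemannian_hessian_quadratic_form C1_has_derivative[OF M'] C1_has_derivative[OF g] pd)
    then have "rate x v = - 2 * (v \<bullet> (riemannian_hessian M f x *v v))"
      unfolding rate_def F'(2) G'_apply
      by (simp add: inner_diff_right bounded_linear_Blinfun_apply bounded_linear_minus bounded_linear_ident)
    then show "rate x v \<le> 0" using convex[of v x] by simp
  qed
qed

section \<open>The two-player game\<close>

text \<open>Linear in the pair of matrices, so that the derivative of the product metric follows
  from those of its blocks.\<close>

definition block_blinfun :: "(real^'m::finite^'m) \<times> (real^'n::finite^'n) \<Rightarrow>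
    (((real^'m) \<times> (real^'n)) \<Rightarrow>\<^sub>L ((real^'m) \<times> (real^'n)))" where
  "block_blinfun A = Blinfun (\<lambda>v. (fst A *v fst v, snd A *v snd v))"

lemma block_blinfun_apply [simp]:
  "blinfun_apply (block_blinfun A) v = (fst A *v fst v, snd A *v snd v)"
proof -
  have "bounded_linear (\<lambda>v. (fst A *v fst v, snd A *v snd v))"
    by (intro bounded_linear_Pair bounded_linear_compose[OF matrix_vector_mul_bounded_linear]
        bounded_linear_fst bounded_linear_snd)
  then show ?thesis by (simp add: block_blinfun_def bounded_linear_Blinfun_apply)
qed

lemma bounded_linear_block_blinfun: "bounded_linear block_blinfun"
  by (subst linear_conv_bounded_linear[symmetric], rule linearI)
    (auto intro!: blinfun_eqI simp: blinfun.bilinear_simps matrix_vector_mult_add_rdistrib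
      scaleR_matrix_vector_assoc)

lemma has_derivative_gradient_zero_at_minimum:
  fixes f :: "'a::euclidean_space \<Rightarrow> real"
  assumes f: "(f has_derivative (\<lambda>v. g \<bullet> v)) (at x)" and min: "\<And>y. f x \<le> f y"
  shows "g = 0"
proof -
  have "(\<lambda>v. g \<bullet> v) = (\<lambda>v. 0)"
    using differential_zero_maxmin[of x UNIV f "\<lambda>v. g \<bullet> v"] f min by auto
  then have "g \<bullet> g = 0" by metis
  then show ?thesis by simp
qed

text \<open>Of the two off-diagonal blocks of \<open>H\<close>, this is the one taking variations of
  player 1 to the gradient of player 2; the other one is reached through the symmetry of
  \<open>H\<close>.\<close>

lemma mixed_hessian_bilinear_form:
  fixes f :: "real^'m::finite \<Rightarrow> real^'n::finite \<Rightarrow> real"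
  assumes f: "\<And>x. ((\<lambda>(x1, x2). f x1 x2) has_derivative (\<lambda>v. g x \<bullet> v)) (at x)"
    and g: "has_C1_derivative g H"
  shows "v \<bullet> (mixed_hessian f x1 x2 *v w) = snd (H (x1, x2) (v, 0)) \<bullet> w"
proof -
  have 1: "partial_deriv j (\<lambda>y2. f y1 y2) x2 = snd (g (y1, x2)) $ j" for j y1
  proof -
    have "((\<lambda>y2. (y1, y2)) has_derivative (\<lambda>v. (0, v))) (at x2)"
      by (intro has_derivative_Pair has_derivative_const has_derivative_ident)
    from has_derivative_compose[OF this f]
    have "((\<lambda>y2. f y1 y2) has_derivative (\<lambda>v. g (y1, x2) \<bullet> (0, v))) (at x2)" by simp
    from partial_deriv_eq[OF this] show ?thesis by (simp add: inner_prod_def inner_axis)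
  qed
  have entry: "mixed_hessian f x1 x2 $ i $ j = snd (H (x1, x2) (axis i 1, 0)) $ j" for i j
  proof -
    have "((\<lambda>y1. (y1, x2)) has_derivative (\<lambda>v. (v, 0))) (at x1)"
      by (intro has_derivative_Pair has_derivative_const has_derivative_ident)
    from has_derivative_compose[OF this C1_has_derivative[OF g]]
    have "((\<lambda>y1. snd (g (y1, x2)) $ j) has_derivative (\<lambda>v. snd (H (x1, x2) (v, 0)) $ j)) (at x1)"
      by (intro bounded_linear.has_derivative[OF bounded_linear_vec_nth] has_derivative_snd)
    from partial_deriv_eq[OF this] show ?thesis by (simp add: mixed_hessian_def 1)
  qed
  have "linear (\<lambda>v. snd (H (x1, x2) (v, 0)))"
    by (intro bounded_linear.linear bounded_linear_compose[OF bounded_linear_snd]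
        bounded_linear_compose[OF blinfun.bounded_linear_right] bounded_linear_Pair
        bounded_linear_ident bounded_linear_zero)
  from linear_axis_sum[OF this, of v]
  have "snd (H (x1, x2) (v, 0)) \<bullet> w = (\<Sum>i\<in>UNIV. v $ i * (snd (H (x1, x2) (axis i 1, 0)) \<bullet> w))"
    by (simp add: inner_sum_left)
  then show ?thesis
    unfolding matrix_quadratic_form entry by (simp add: inner_vec_def sum_distrib_left mult_ac)
qed

theorem theorem6:
  fixes f1 f2 :: "real^'m::finite \<Rightarrow> real^'n::finite \<Rightarrow> real"
    and M1 :: "real^'m \<Rightarrow> real^'m^'m"
    and M2 :: "real^'n \<Rightarrow> real^'n^'n"
    and \<alpha>1 k :: real
  assumes smooth_f1: "C_class 2 (\<lambda>(x1, x2). f1 x1 x2)"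
    and smooth_f2: "C_class 2 (\<lambda>(x1, x2). f2 x1 x2)"
    and smooth_M1: "C_class 1 M1"
    and smooth_M2: "C_class 1 M2"
    and metric_M1: "riemannian_metric M1" "uniformly_positive_definite M1"
    and metric_M2: "riemannian_metric M2" "uniformly_positive_definite M2"
    and strongly_convex: "\<alpha>1 > 0" "\<And>x2. geodesically_strongly_convex \<alpha>1 M1 (\<lambda>x1. f1 x1 x2)"
    and convex: "\<And>x1 x2. positive_semidefinite (riemannian_hessian M2 (\<lambda>y2. f2 x1 y2) x2)"
    and skew: "k > 0" "\<And>x1 x2. mixed_hessian f1 x1 x2 = - k *\<^sub>R mixed_hessian f2 x1 x2"
    and bounded_trajectory: "\<exists>T x. trajectory (natural_gradient_field f1 f2 M1 M2) T x \<and>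
      bounded (x ` time_domain T)"
  shows "\<exists>x1s.
    (\<forall>T x. trajectory (natural_gradient_field f1 f2 M1 M2) T x \<longrightarrow>
      T = \<infinity> \<and> (\<exists>x2s. nash_equilibrium f1 f2 x1s x2s \<and> (x \<longlongrightarrow> (x1s, x2s)) at_top)) \<and>
    (\<forall>y1 y2. nash_equilibrium f1 f2 y1 y2 \<longrightarrow> y1 = x1s)"
proof -

  \<comment> \<open>Derivatives of the costs and the metrics\<close>
  obtain g1 H1 where g1: "\<And>x. ((\<lambda>(x1, x2). f1 x1 x2) has_derivative (\<lambda>v. g1 x \<bullet> v)) (at x)"
    and H1: "has_C1_derivative g1 H1"
    using C_class_2_gradient[OF smooth_f1] by blast
  obtain g2 H2 where g2: "\<And>x. ((\<lambda>(x1, x2). f2 x1 x2) has_derivative (\<lambda>v. g2 x \<bullet> v)) (at x)"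
    and H2: "has_C1_derivative g2 H2"
    using C_class_2_gradient[OF smooth_f2] by blast
  obtain M1' where M1': "has_C1_derivative M1 M1'" using C_class_1_derivative[OF smooth_M1] by blast
  obtain M2' where M2': "has_C1_derivative M2 M2'" using C_class_1_derivative[OF smooth_M2] by blast
  obtain \<beta>1 where \<beta>1: "\<beta>1 > 0" "\<And>x v. \<beta>1 * (norm v)\<^sup>2 \<le> v \<bullet> (M1 x *v v)"
    using uniformly_positive_definite_coercive[OF metric_M1(2)] by blast
  obtain \<beta>2 where \<beta>2: "\<beta>2 > 0" "\<And>x v. \<beta>2 * (norm v)\<^sup>2 \<le> v \<bullet> (M2 x *v v)"
    using uniformly_positive_definite_coercive[OF metric_M2(2)] by blast
  have pd1: "positive_definite (M1 x)" for x using metric_M1(1) by (simp add: riemannian_metric_def)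
  have pd2: "positive_definite (M2 x)" for x using metric_M2(1) by (simp add: riemannian_metric_def)
  have sym1: "v \<bullet> (M1 x *v w) = w \<bullet> (M1 x *v v)" for v w x
    by (rule positive_definite_symmetric[OF pd1])
  have sym2: "v \<bullet> (M2 x *v w) = w \<bullet> (M2 x *v v)" for v w x
    by (rule positive_definite_symmetric[OF pd2])

  have f1: "((\<lambda>x1. f1 x1 x2) has_derivative (\<lambda>v. fst (g1 (x1, x2)) \<bullet> v)) (at x1)" for x1 x2
  proof -
    have "((\<lambda>x1. (x1, x2)) has_derivative (\<lambda>v. (v, 0))) (at x1)"
      by (intro has_derivative_Pair has_derivative_const has_derivative_ident)
    from has_derivative_compose[OF this g1] show ?thesis by (simp add: inner_prod_def)
  qed
  have f2: "((\<lambda>x2. f2 x1 x2) has_derivative (\<lambda>v. snd (g2 (x1, x2)) \<bullet> v)) (at x2)" for x1 x2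
  proof -
    have "((\<lambda>x2. (x1, x2)) has_derivative (\<lambda>v. (0, v))) (at x2)"
      by (intro has_derivative_Pair has_derivative_const has_derivative_ident)
    from has_derivative_compose[OF this g2] show ?thesis by (simp add: inner_prod_def)
  qed
  have grad1: "gradient (\<lambda>x1. f1 x1 x2) = (\<lambda>x1. fst (g1 (x1, x2)))" for x2
    using gradient_eq[OF f1] by auto
  have grad2: "gradient (\<lambda>x2. f2 x1 x2) = (\<lambda>x2. snd (g2 (x1, x2)))" for x1
    using gradient_eq[OF f2] by auto
  have inc1: "bounded_linear (\<lambda>v :: real^'m. (v, 0 :: real^'n))"
    and inc2: "bounded_linear (\<lambda>v :: real^'n. (0 :: real^'m, v))"
    by (intro bounded_linear_Pair bounded_linear_ident bounded_linear_zero)+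
  \<comment> \<open>\<open>(0, x2) + (x1, 0)\<close> is the point \<open>(x1, x2)\<close> in the
    affine form to which the chain rule for C1 maps applies.\<close>
  define h1 where "h1 x2 x1 = Blinfun fst o\<^sub>L (H1 ((0, x2) + (x1, 0)) o\<^sub>L Blinfun (\<lambda>v. (v, 0)))" for x1 x2
  define h2 where "h2 x1 x2 = Blinfun snd o\<^sub>L (H2 ((x1, 0) + (0, x2)) o\<^sub>L Blinfun (\<lambda>v. (0, v)))" for x1 x2
  have C1_grad1: "has_C1_derivative (gradient (\<lambda>x1. f1 x1 x2)) (h1 x2)" for x2
    using C1_bounded_linear[OF C1_compose_affine[OF H1 inc1, of "(0, x2)"] bounded_linear_fst]
    by (simp add: grad1 h1_def[abs_def])
  have C1_grad2: "has_C1_derivative (gradient (\<lambda>x2. f2 x1 x2)) (h2 x1)" for x1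
    using C1_bounded_linear[OF C1_compose_affine[OF H2 inc2, of "(x1, 0)"] bounded_linear_snd]
    by (simp add: grad2 h2_def[abs_def])
  have h1_apply: "h1 x2 x1 v = fst (H1 (x1, x2) (v, 0))" for x1 x2 v
    by (simp add: h1_def bounded_linear_Blinfun_apply bounded_linear_fst inc1)
  have h2_apply: "h2 x1 x2 v = snd (H2 (x1, x2) (0, v))" for x1 x2 v
    by (simp add: h2_def bounded_linear_Blinfun_apply bounded_linear_snd inc2)

  have convex1: "\<alpha>1 * (v \<bullet> (M1 x1 *v v)) \<le> v \<bullet> (riemannian_hessian M1 (\<lambda>x1. f1 x1 x2) x1 *v v)" for v x1 x2
    using strongly_convex(2)[of x2]
    unfolding geodesically_strongly_convex_def loewner_ge_def positive_semidefinite_def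
    by (simp add: matrix_vector_mult_diff_rdistrib inner_diff_right scaleR_matrix_vector_assoc[symmetric])
  have convex1': "\<alpha>1 * \<beta>1 * (norm v)\<^sup>2 \<le> v \<bullet> (riemannian_hessian M1 (\<lambda>x1. f1 x1 x2) x1 *v v)" for v x1 x2
    unfolding mult.assoc using strongly_convex(1)
    by (intro order_trans[OF _ convex1] mult_left_mono \<beta>1(2)) auto
  have convex2: "0 \<le> v \<bullet> (riemannian_hessian M2 (\<lambda>x2. f2 x1 x2) x2 *v v)" for v x1 x2
    using convex unfolding positive_semidefinite_def by blast

  \<comment> \<open>The product metric and its Lie derivative along the dynamics\<close>
  define F where "F = natural_gradient_field f1 f2 M1 M2"
  define G where "G x = block_blinfun (M1 (fst x), k *\<^sub>R M2 (snd x))" for x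
  \<comment> \<open>Right side of the linear system solved by \<open>F x\<close>; being C1, it makes
    \<open>F\<close> a C1 field.\<close>
  define b where "b x = (- fst (g1 x), - k *\<^sub>R snd (g2 x))" for x
  have F_fst: "fst (F x) = - (matrix_inv (M1 (fst x)) *v fst (g1 x))"
    and F_snd: "snd (F x) = - (matrix_inv (M2 (snd x)) *v snd (g2 x))" for x
    by (auto simp: F_def natural_gradient_field_def grad1 grad2 split: prod.split)
  have M1F: "M1 (fst x) *v fst (F x) = - fst (g1 x)" and M2F: "M2 (snd x) *v snd (F x) = - snd (g2 x)" for x
    by (simp_all add: F_fst F_snd linear_neg[OF matrix_vector_mul_linear]
        positive_definite_inverse[OF pd1] positive_definite_inverse[OF pd2])
  have GF: "G x (F x) = b x" for x
    by (simp add: G_def b_def M1F M2F scaleR_matrix_vector_assoc[symmetric])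
  obtain D where D: "has_C1_derivative (\<lambda>x. (M1 (0 + fst x), k *\<^sub>R M2 (0 + snd x))) D"
    "\<And>x v. D x v = ((M1' (0 + fst x) o\<^sub>L Blinfun fst) v,
      (Blinfun (\<lambda>A. k *\<^sub>R A) o\<^sub>L (M2' (0 + snd x) o\<^sub>L Blinfun snd)) v)"
    using C1_Pair[OF C1_compose_affine[OF M1' bounded_linear_fst]
        C1_bounded_linear[OF C1_compose_affine[OF M2' bounded_linear_snd] bounded_linear_scaleR_right]]
    by blast
  have D_apply: "D x v = (M1' (fst x) (fst v), k *\<^sub>R M2' (snd x) (snd v))" for x v
    by (simp add: D(2) bounded_linear_Blinfun_apply bounded_linear_fst bounded_linear_snd
        bounded_linear_scaleR_right)
  define G' where "G' x = Blinfun block_blinfun o\<^sub>L D x" for x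
  have G: "has_C1_derivative G G'"
    using C1_bounded_linear[OF D(1) bounded_linear_block_blinfun] by (simp add: G_def[abs_def] G'_def[abs_def])
  have G'_apply: "G' x u v = (M1' (fst x) (fst u) *v fst v, k *\<^sub>R (M2' (snd x) (snd u) *v snd v))" for x u v
    by (simp add: G'_def bounded_linear_Blinfun_apply bounded_linear_block_blinfun D_apply
        scaleR_matrix_vector_assoc)
  have L1: "bounded_linear (\<lambda>v :: (real^'m) \<times> (real^'n). - fst v)"
    and L2: "bounded_linear (\<lambda>v :: (real^'m) \<times> (real^'n). - k *\<^sub>R snd v)"
    by (intro bounded_linear_minus bounded_linear_fst
        bounded_linear_compose[OF bounded_linear_scaleR_right bounded_linear_snd])+
  obtain b' where "has_C1_derivative (\<lambda>x. (- fst (g1 x), - k *\<^sub>R snd (g2 x))) b'" and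
    b'_def: "\<And>x v. b' x v = ((Blinfun (\<lambda>v. - fst v) o\<^sub>L H1 x) v, (Blinfun (\<lambda>v. - k *\<^sub>R snd v) o\<^sub>L H2 x) v)"
    using C1_Pair[OF C1_bounded_linear[OF H1 L1] C1_bounded_linear[OF H2 L2]] by blast
  then have b': "has_C1_derivative b b'" by (simp add: b_def[abs_def])
  have b'_apply: "b' x v = (- fst (H1 x v), - k *\<^sub>R snd (H2 x v))" for x v
    by (simp only: b'_def blinfun_apply_blinfun_compose bounded_linear_Blinfun_apply[OF L1]
        bounded_linear_Blinfun_apply[OF L2])
  define \<beta> where "\<beta> = min \<beta>1 (k * \<beta>2)"
  have \<beta>: "\<beta> > 0" using \<beta>1 \<beta>2 skew by (simp add: \<beta>_def)
  have coercive: "\<beta> * (norm v)\<^sup>2 \<le> v \<bullet> G x v" for x v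
  proof -
    have "\<beta> * (norm v)\<^sup>2 = \<beta> * (norm (fst v))\<^sup>2 + \<beta> * (norm (snd v))\<^sup>2"
      by (simp add: power2_norm_eq_inner inner_prod_def algebra_simps)
    also have "\<dots> \<le> \<beta>1 * (norm (fst v))\<^sup>2 + (k * \<beta>2) * (norm (snd v))\<^sup>2"
      by (intro add_mono mult_right_mono) (auto simp: \<beta>_def)
    also have "\<dots> \<le> fst v \<bullet> (M1 (fst x) *v fst v) + k * (snd v \<bullet> (M2 (snd x) *v snd v))"
      unfolding mult.assoc using skew by (intro add_mono mult_left_mono \<beta>1(2) \<beta>2(2)) auto
    also have "\<dots> = v \<bullet> G x v"
      by (simp add: G_def inner_prod_def scaleR_matrix_vector_assoc[symmetric])
    finally show ?thesis .
  qed
  obtain F' where F': "has_C1_derivative F F'" "\<And>x v. G x (F' x v) = b' x v - G' x v (F x)"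
    using coercive_solution_C1[OF \<beta> coercive G b' GF] by blast
  \<comment> \<open>The Lie derivative pairs the block of \<open>f1\<close> acting on
    \<open>snd v\<close> with the block of \<open>f2\<close> acting on \<open>fst v\<close>, while
    the skew-symmetry compares blocks of the same type. Symmetry of \<open>H1\<close> bridges the
    gap, and the weight \<open>k\<close> then gives the cancellation.\<close>
  have cross: "fst v \<bullet> fst (H1 x (0, snd v)) + k * (snd v \<bullet> snd (H2 x (fst v, 0))) = 0" for x v
  proof -
    have "fst v \<bullet> fst (H1 x (0, snd v)) = H1 x (0, snd v) \<bullet> (fst v, 0)"
      by (simp add: inner_prod_def inner_commute)
    also have "\<dots> = H1 x (fst v, 0) \<bullet> (0, snd v)" by (rule gradient_derivative_symmetric[OF g1 H1])
    also have "\<dots> = snd (H1 (fst x, snd x) (fst v, 0)) \<bullet> snd v" by (simp add: inner_prod_def)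
    also have "\<dots> = fst v \<bullet> (mixed_hessian f1 (fst x) (snd x) *v snd v)"
      by (rule mixed_hessian_bilinear_form[OF g1 H1, symmetric])
    also have "\<dots> = - k * (fst v \<bullet> (mixed_hessian f2 (fst x) (snd x) *v snd v))"
      by (simp only: skew(2) scaleR_matrix_vector_assoc[symmetric] inner_scaleR_right)
    also have "fst v \<bullet> (mixed_hessian f2 (fst x) (snd x) *v snd v) = snd (H2 x (fst v, 0)) \<bullet> snd v"
      using mixed_hessian_bilinear_form[OF g2 H2, of "fst v" "fst x" "snd x"] by simp
    finally show ?thesis by (simp add: inner_commute)
  qed
  have metric: "riemannian_field G G' F F' \<beta>"
  proof
    show "v \<bullet> G x w = w \<bullet> G x v" for v x w
      using sym1 sym2
      by (simp add: G_def inner_prod_def scaleR_matrix_vector_assoc[symmetric])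
  qed (use G F' \<beta> coercive in auto)
  \<comment> \<open>The constant combines strong convexity, \<open>\<alpha>1\<close>, with the
    Euclidean lower bound \<open>\<beta>1\<close> of \<open>M1\<close>; the \<open>2\<close> is that
    of \<open>rate = - 2\<close> times the Hessians.\<close>
  interpret semicontracting_field G G' F F' \<beta> fst_blinfun "2 * (\<alpha>1 * \<beta>1)"
  proof (intro semicontracting_field.intro metric semicontracting_field_axioms.intro)
    show "2 * (\<alpha>1 * \<beta>1) > 0" using strongly_convex(1) \<beta>1(1) by simp
    fix x v :: "(real^'m) \<times> (real^'n)"
    define R1 where "R1 = riemannian_hessian M1 (\<lambda>x1. f1 x1 (snd x)) (fst x)"
    define R2 where "R2 = riemannian_hessian M2 (\<lambda>x2. f2 (fst x) x2) (snd x)"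
    have R1: "fst v \<bullet> (R1 *v fst v) = fst v \<bullet> fst (H1 x (fst v, 0))
        + fst v \<bullet> (M1' (fst x) (fst v) *v fst (F x)) - 1 / 2 * (fst v \<bullet> (M1' (fst x) (fst (F x)) *v fst v))"
      using riemannian_hessian_quadratic_form[OF C1_has_derivative[OF M1']
          C1_has_derivative[OF C1_grad1[of "snd x"]] pd1[of "fst x"], where v = "fst v"]
      by (simp add: R1_def grad1 F_fst h1_apply)
    have R2: "snd v \<bullet> (R2 *v snd v) = snd v \<bullet> snd (H2 x (0, snd v))
        + snd v \<bullet> (M2' (snd x) (snd v) *v snd (F x)) - 1 / 2 * (snd v \<bullet> (M2' (snd x) (snd (F x)) *v snd v))"
      using riemannian_hessian_quadratic_form[OF C1_has_derivative[OF M2']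
          C1_has_derivative[OF C1_grad2[of "fst x"]] pd2[of "snd x"], where v = "snd v"]
      by (simp add: R2_def grad2 F_snd h2_apply)
    have split: "H1 x v = H1 x (fst v, 0) + H1 x (0, snd v)" "H2 x v = H2 x (fst v, 0) + H2 x (0, snd v)"
      by (simp_all add: blinfun.add_right[symmetric])
    \<comment> \<open>The diagonal blocks of \<open>H1\<close> and \<open>H2\<close> complete the
      two Riemannian Hessians; the off-diagonal ones make up the last bracket, which vanishes by
      \<open>cross\<close>.\<close>
    have "riemannian_field.rate G G' F F' x v
       = - 2 * (fst v \<bullet> (R1 *v fst v)) - 2 * k * (snd v \<bullet> (R2 *v snd v))
         - 2 * (fst v \<bullet> fst (H1 x (0, snd v)) + k * (snd v \<bullet> snd (H2 x (fst v, 0))))"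
      unfolding riemannian_field.rate_def[OF metric] F'(2) b'_apply G'_apply R1 R2 split
      by (simp add: inner_prod_def inner_add_right inner_diff_right algebra_simps)
    also have "\<dots> \<le> - 2 * (\<alpha>1 * \<beta>1 * (norm (fst v))\<^sup>2) - 0 - 0"
      using convex1'[of "fst v" "snd x" "fst x"] convex2[of "snd v" "fst x" "snd x"] skew(1)
      unfolding cross R1_def R2_def by (intro diff_mono) auto
    finally show "riemannian_field.rate G G' F F' x v
        \<le> - (2 * (\<alpha>1 * \<beta>1)) * (norm (fst_blinfun v))\<^sup>2" by simp
  qed

  \<comment> \<open>Zeros of the field and Nash equilibria\<close>
  have equilibrium_iff: "F x = 0 \<longleftrightarrow> fst (g1 x) = 0 \<and> snd (g2 x) = 0" for x
  proof
    assume "F x = 0"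
    then show "fst (g1 x) = 0 \<and> snd (g2 x) = 0" using M1F[of x, symmetric] M2F[of x, symmetric] by simp
  next
    assume "fst (g1 x) = 0 \<and> snd (g2 x) = 0"
    then have "fst (F x) = 0" "snd (F x) = 0" by (simp_all add: F_fst F_snd)
    then show "F x = 0" by (simp add: prod_eq_iff)
  qed
  have nash_iff: "nash_equilibrium f1 f2 (fst x) (snd x) \<longleftrightarrow> F x = 0" for x
  proof
    assume "nash_equilibrium f1 f2 (fst x) (snd x)"
    then have "fst (g1 (fst x, snd x)) = 0" "snd (g2 (fst x, snd x)) = 0"
      unfolding nash_equilibrium_def
      using has_derivative_gradient_zero_at_minimum[OF f1] has_derivative_gradient_zero_at_minimum[OF f2]
      by blast+
    then show "F x = 0" by (simp add: equilibrium_iff)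
  next
    assume "F x = 0"
    then have z: "fst (g1 (fst x, snd x)) = 0" "snd (g2 (fst x, snd x)) = 0" by (simp_all add: equilibrium_iff)
    have "f1 (fst x) (snd x) \<le> f1 y1 (snd x)" for y1
    proof (rule critical_point_global_minimum[OF smooth_M1 metric_M1 _ C1_grad1])
      show "((\<lambda>x1. f1 x1 (snd x)) has_derivative (\<lambda>v. gradient (\<lambda>x1. f1 x1 (snd x)) x1 \<bullet> v)) (at x1)" for x1
        by (simp add: grad1 f1)
      show "0 \<le> v \<bullet> (riemannian_hessian M1 (\<lambda>x1. f1 x1 (snd x)) x1 *v v)" for x1 v
        using convex1'[of v "snd x" x1] strongly_convex(1) \<beta>1(1)
        by (meson mult_nonneg_nonneg less_imp_le order_trans zero_le_power2)
    qed (use z in \<open>simp add: grad1\<close>)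
    moreover have "f2 (fst x) (snd x) \<le> f2 (fst x) y2" for y2
    proof (rule critical_point_global_minimum[OF smooth_M2 metric_M2 _ C1_grad2])
      show "((\<lambda>x2. f2 (fst x) x2) has_derivative (\<lambda>v. gradient (\<lambda>x2. f2 (fst x) x2) x2 \<bullet> v)) (at x2)" for x2
        by (simp add: grad2 f2)
    qed (use z in \<open>simp_all add: grad2 convex2\<close>)
    ultimately show "nash_equilibrium f1 f2 (fst x) (snd x)" by (simp add: nash_equilibrium_def)
  qed

  \<comment> \<open>Dissipation along bounded solutions\<close>
  define \<Phi> where "\<Phi> x = k * (case x of (x1, x2) \<Rightarrow> f2 x1 x2)" for x
  have \<Phi>: "(\<Phi> has_derivative (\<lambda>v. k * (g2 x \<bullet> v))) (at x)" for x
    unfolding \<Phi>_def by (intro has_derivative_mult_right g2)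
  have dissipation: "\<exists>L\<ge>0. \<forall>x. norm x \<le> R \<longrightarrow>
      k * (g2 x \<bullet> F x) \<le> \<epsilon> + L * (norm (fst_blinfun (F x)))\<^sup>2 - speed x" if \<epsilon>: "\<epsilon> > 0" for R \<epsilon>
  proof -
    obtain K where K: "K \<ge> 1" "\<And>x. norm x \<le> R \<Longrightarrow>
        norm (G x) \<le> K \<and> norm (G' x) \<le> K \<and> norm (F x) \<le> K \<and> norm (F' x) \<le> K"
      by (rule bounds_on_ball[of R]) blast
    have "bounded (g2 ` cball 0 R)"
      by (intro compact_imp_bounded compact_continuous_image C1_continuous[OF H2] compact_cball)
    then obtain A where A: "\<forall>x\<in>cball 0 R. norm (g2 x) \<le> A" unfolding bounded_iff by auto
    have "k * (g2 x \<bullet> F x) \<le> \<epsilon> + ((k * A)\<^sup>2 / (4 * \<epsilon>) + K) * (norm (fst_blinfun (F x)))\<^sup>2 - speed x"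
      if x: "norm x \<le> R" for x
    proof -
      define n where "n = norm (fst (F x))"
      \<comment> \<open>Player 2's share of the speed cancels in
        \<open>k * (g2 x \<bullet> F x) + speed x\<close>, leaving only terms with
        \<open>fst (F x)\<close>.\<close>
      have speed: "speed x = fst (F x) \<bullet> (M1 (fst x) *v fst (F x)) - k * (snd (g2 x) \<bullet> snd (F x))"
        by (simp add: speed_def G_def inner_prod_def scaleR_matrix_vector_assoc[symmetric] M2F inner_commute)
      have "(fst (F x), 0) \<bullet> G x (fst (F x), 0) \<le> n * (K * n)"
        using K(2)[OF x] by (intro inner_blinfun_le) (auto simp: norm_Pair n_def)
      then have 1: "fst (F x) \<bullet> (M1 (fst x) *v fst (F x)) \<le> K * n\<^sup>2"
        by (simp add: G_def inner_prod_def power2_eq_square mult_ac)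
      have "fst (g2 x) \<bullet> fst (F x) \<le> A * n"
      proof -
        have "norm (fst (g2 x)) \<le> A" using A x norm_fst_le[of "fst (g2 x)" "snd (g2 x)"] by force
        then have "norm (fst (g2 x)) * n \<le> A * n" by (intro mult_right_mono) (auto simp: n_def)
        then show ?thesis using norm_cauchy_schwarz[of "fst (g2 x)" "fst (F x)"] by (simp add: n_def)
      qed
      then have "k * (fst (g2 x) \<bullet> fst (F x)) \<le> k * A * n" using skew(1) by (simp add: mult.assoc)
      also have "\<dots> \<le> \<epsilon> + (k * A)\<^sup>2 / (4 * \<epsilon>) * n\<^sup>2"
      proof -
        \<comment> \<open>A completed square trades the term linear in \<open>n\<close> for a
          quadratic one at the cost of \<open>\<epsilon>\<close>.\<close>
        have "0 \<le> (2 * \<epsilon> - k * A * n)\<^sup>2 / (4 * \<epsilon>)" using \<epsilon> by simp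
        also have "\<dots> = \<epsilon> + (k * A)\<^sup>2 / (4 * \<epsilon>) * n\<^sup>2 - k * A * n"
          using \<epsilon> by (simp add: power2_eq_square field_simps)
        finally show ?thesis by simp
      qed
      finally have 2: "k * (fst (g2 x) \<bullet> fst (F x)) \<le> \<epsilon> + (k * A)\<^sup>2 / (4 * \<epsilon>) * n\<^sup>2" .
      have "k * (g2 x \<bullet> F x) = k * (fst (g2 x) \<bullet> fst (F x)) + k * (snd (g2 x) \<bullet> snd (F x))"
        by (simp add: inner_prod_def algebra_simps)
      then show ?thesis using 1 2 unfolding speed n_def[symmetric] blinfun_apply_fst_blinfun
        by (simp add: algebra_simps)
    qed
    moreover have "0 \<le> (k * A)\<^sup>2 / (4 * \<epsilon>) + K" using K(1) \<epsilon> by (simp add: add_nonneg_nonneg)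
    ultimately show ?thesis by blast
  qed

  \<comment> \<open>Convergence of every trajectory\<close>
  have dom_inf: "time_domain \<infinity> = {0..}" by (auto simp: time_domain_def)
  have bounded_converges: "\<exists>p. F p = 0 \<and> (x \<longlongrightarrow> p) at_top \<and> T = \<infinity>"
    if traj: "trajectory F T x" and bounded: "bounded (x ` time_domain T)" for T x
  proof -
    have T: "T = \<infinity>" by (rule bounded_trajectory_global[OF F'(1) traj bounded])
    have x: "(x has_vector_derivative F (x t)) (at t within {0..})" if "t \<ge> 0" for t
      using traj that unfolding trajectory_def solution_def T dom_inf by simp
    have bx: "bounded (x ` {0..})" using bounded by (simp add: T dom_inf)
    have "((\<lambda>t. speed (x t)) \<longlongrightarrow> 0) at_top"
      by (rule speed_tendsto_0[OF x bx \<Phi> dissipation])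
    from bounded_solution_converges[OF x bx this]
    obtain p where "F p = 0" "(x \<longlongrightarrow> p) at_top" by blast
    then show ?thesis using T by blast
  qed
  \<comment> \<open>The equilibrium supplied by the bounded trajectory is the base point from which
    every other trajectory is measured.\<close>
  obtain p where p: "F p = 0" using bounded_trajectory bounded_converges unfolding F_def[symmetric] by blast
  \<comment> \<open>The lifetime \<open>T\<close> is arbitrary here: the distance bound precedes
    global existence and implies it through \<open>bounded_converges\<close>.\<close>
  have trajectory_bounded: "bounded (x ` time_domain T)" if traj: "trajectory F T x" for T x
  proof -
    have x: "(x has_vector_derivative F (x t)) (at t within time_domain T)" if "t \<in> time_domain T" for t
      using traj that by (simp add: trajectory_def solution_def)
    have "norm (x t) \<le> norm p + sqrt (min_energy p (x 0) / \<beta>)" if t: "t \<in> time_domain T" for t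
    proof -
      have sub: "{0..t} \<subseteq> time_domain T" using t unfolding time_domain_def
        by (auto intro: le_less_trans[of "ereal _" "ereal t" T])
      have "min_energy p (x t) \<le> min_energy p (x 0)"
        using t sub
        by (intro min_energy_decreasing[OF p] has_vector_derivative_within_subset[OF x])
          (auto simp: time_domain_def)
      then have "(norm (x t - p))\<^sup>2 \<le> min_energy p (x 0) / \<beta>"
        using norm_diff_le_min_energy[of "x t" p] \<beta> by (simp add: field_simps)
      then have "norm (x t - p) \<le> sqrt (min_energy p (x 0) / \<beta>)" by (rule real_le_rsqrt)
      then show ?thesis using norm_triangle_ineq[of p "x t - p"] by simp
    qed
    then show ?thesis unfolding bounded_iff by blast
  qed
  show ?thesis unfolding F_def[symmetric]
  proof (intro exI[of _ "fst p"] conjI allI impI)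
    fix T x assume traj: "trajectory F T x"
    obtain q where q: "F q = 0" "(x \<longlongrightarrow> q) at_top" "T = \<infinity>"
      using bounded_converges[OF traj trajectory_bounded[OF traj]] by blast
    \<comment> \<open>The limit may differ from \<open>p\<close>, but only in the strategy of player
      2.\<close>
    have "fst q = fst p" using equilibria_unique[OF q(1) p] by simp
    then have q_eq: "q = (fst p, snd q)" by (simp add: prod_eq_iff)
    show "T = \<infinity>" by (rule q)
    show "\<exists>x2s. nash_equilibrium f1 f2 (fst p) x2s \<and> (x \<longlongrightarrow> (fst p, x2s)) at_top"
      using nash_iff[of q] q q_eq by (metis fst_conv)
  next
    fix y1 y2 assume "nash_equilibrium f1 f2 y1 y2"
    then have "F (y1, y2) = 0" using nash_iff[of "(y1, y2)"] by simp
    then show "y1 = fst p" using equilibria_unique[OF _ p] by fastforce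
  qed
qed

end
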